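(* Let $I$ be a finite set with $\#I\ge2$, let $0<\overline{\alpha}<1$, and suppose that for each $i\in I$ there is an invertible matrix $A_i\in\mathbb{R}^{d\times d}$ with $\|A_i\|\le\overline{\alpha}$. Suppose that $K\subset I^\infty$ is a nonempty compact set with $\sigma(K)\subset K$. If $t\in(0,d)\setminus\mathbb{N}$ and $\mu$ is a $(K,t)$-equilibrium measure, then $$P_K'(t-)\le\lambda_{l+1}(\mu)\le P_K'(t+),$$ where $l=\lfloor t\rfloor$. In fact, for all but at most countably many points $t\in(0,d)$, the derivative $P_K'(t)$ exists and $P_K'(t)=\lambda_{l+1}(\mu)$ for every $(K,t)$-equilibrium measure $\mu$, where $l=\lfloor t\rfloor$.
   Context: $I^\infty=I^{\mathbb{N}}$ carries the (compact, metrizable) product topology of the discrete set $I$, and $\sigma(i_1,i_2,\ldots)=(i_2,i_3,\ldots)$ is the left shift. For $\mathtt{i}\in I^\infty$, $\mathtt{i}|_n\in I^n$ is its initial word of length $n$; for $\mathtt{i}\in I^n$, $[\mathtt{i}]=\{\mathtt{j}\in I^\infty:\mathtt{j}|_n=\mathtt{i}\}$ is the cylinder and $A_{\mathtt{i}}=A_{i_1}\cdots A_{i_n}$. For $K\subset I^\infty$, $K_n=\{\mathtt{i}|_n:\mathtt{i}\in K\}$. $\|\cdot\|$ is the Euclidean operator norm and $\alpha_1(A)\ge\cdots\ge\alpha_d(A)>0$ are the singular values of an invertible $A\in\mathbb{R}^{d\times d}$. The singular value function is $\varphi^t(A)=\alpha_1(A)\cdots\alpha_l(A)\,\alpha_{l+1}(A)^{t-l}$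 for $0\le t<d$, $l=\lfloor t\rfloor$, and $\varphi^t(A)=|\det A|^{t/d}$ for $t\ge d$. For nonempty $K$ with $\sigma(K)\subset K$, the topological pressure is $P_K(t)=\lim_{n\to\infty}\frac1n\log\sum_{\mathtt{i}\in K_n}\varphi^t(A_{\mathtt{i}})$, $t\ge0$ (the limit exists by subadditivity). Its one-sided derivatives are $P_K'(t-)=\lim_{\delta\uparrow0}\frac{P_K(t+\delta)-P_K(t)}{\delta}$ and $P_K'(t+)=\lim_{\delta\downarrow0}\frac{P_K(t+\delta)-P_K(t)}{\delta}$. $\mathcal{M}_\sigma(K)$ is the set of $\sigma$-invariant Borel probability measures on $I^\infty$ whose support is contained in $K$. For $\mu\in\mathcal{M}_\sigma(K)$, with $H(x)=-x\log x$ for $0<x\le1$ and $H(0)=0$, the entropy is $h(\mu)=\lim_{n\to\infty}\frac1n\sum_{\mathtt{i}\in I^n}H(\mu([\mathtt{i}]))$, the $t$-energy is $\Lambda^t(\mu)=\lim_{n\to\infty}\frac1n\sum_{\mathtt{i}\in I^n}\mu([\mathtt{i}])\log\varphi^t(A_{\mathtt{i}})$, and $\lambda_m(\mu)=\lim_{n\to\infty}\frac1n\sum_{\mathtt{i}\in K_n}\mu([\mathtt{i}])\log\alpha_m(A_{\mathtt{i}})$ for $m\in\{1,\ldots,d\}$ (all limits exist). A measure $\mu\in\mathcal{M}_\sigma(K)$ is a $(K,t)$-equilibrium measure if $P_K(t)=h(\mu)+\Lambda^t(\mu)$. *)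

theory Defs
  imports "HOL-Probability.Probability_Measure" "HOL-Computational_Algebra.Polynomial"
begin

text \<open>
  The alphabet is a finite type \<open>'i\<close> carrying the discrete topology, so that the type class
  instances for functions equip the sequence space \<open>nat \<Rightarrow> 'i\<close> with the product topology and
  its Borel sigma-algebra. Sequences are indexed from 0; finite words are lists.
\<close>

definition shift :: "(nat \<Rightarrow> 'i) \<Rightarrow> nat \<Rightarrow> 'i" where
  "shift x = (\<lambda>n. x (Suc n))"

definition initial_word :: "(nat \<Rightarrow> 'i) \<Rightarrow> nat \<Rightarrow> 'i list" where
  "initial_word x n = map x [0..<n]"

definition cylinder :: "'i list \<Rightarrow> (nat \<Rightarrow> 'i) set" where
  "cylinder w = {x. initial_word x (length w) = w}"

definition all_words :: "nat \<Rightarrow> 'i list set" where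
  "all_words n = {w. length w = n}"

definition words_of :: "(nat \<Rightarrow> 'i) set \<Rightarrow> nat \<Rightarrow> 'i list set" where
  "words_of K n = (\<lambda>x. initial_word x n) ` K"

definition word_matrix :: "('i \<Rightarrow> real^'d^'d) \<Rightarrow> 'i list \<Rightarrow> real^'d^'d" where
  "word_matrix A w = foldr (\<lambda>i B. A i ** B) w (mat 1)"

text \<open>The polynomial \<open>det (X - M)\<close>.\<close>

definition charpoly :: "real^'d^'d \<Rightarrow> real poly" where
  "charpoly M = det (\<chi> i j. (if i = j then [:0, 1:] else 0) - [:M $ i $ j:])"

text \<open>
  The singular values are the square roots of the eigenvalues of \<open>transpose A ** A\<close>, counted with
  multiplicity (as roots of the characteristic polynomial), in decreasing order.
  They are numbered from 1: \<open>sing_val A m\<close> is meaningful for \<open>1 \<le> m \<le> CARD('d)\<close>.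
\<close>

definition sing_vals :: "real^'d^'d \<Rightarrow> real list" where
  "sing_vals A =
     rev (sorted_list_of_multiset (image_mset sqrt (proots (charpoly (transpose A ** A)))))"

definition sing_val :: "real^'d^'d \<Rightarrow> nat \<Rightarrow> real" where
  "sing_val A m = sing_vals A ! (m - 1)"

definition svf :: "real \<Rightarrow> real^'d^'d \<Rightarrow> real" where
  "svf t A =
     (if t < real CARD('d)
      then let l = nat \<lfloor>t\<rfloor>
           in (\<Prod>m = 1..l. sing_val A m) * sing_val A (l + 1) powr (t - real l)
      else \<bar>det A\<bar> powr (t / real CARD('d)))"

definition pressure :: "('i \<Rightarrow> real^'d^'d) \<Rightarrow> (nat \<Rightarrow> 'i) set \<Rightarrow> real \<Rightarrow> real" where
  "pressure A K t = lim (\<lambda>n. 1 / real n * ln (\<Sum>w\<in>words_of K n. svf t (word_matrix A w)))"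

definition measure_support :: "'a::topological_space measure \<Rightarrow> 'a set" where
  "measure_support \<mu> = {x. \<forall>U. open U \<and> x \<in> U \<longrightarrow> emeasure \<mu> U > 0}"

definition invariant_measures ::
    "(nat \<Rightarrow> 'i::{finite, discrete_topology}) set \<Rightarrow> (nat \<Rightarrow> 'i) measure set" where
  "invariant_measures K =
     {\<mu>. sets \<mu> = sets borel \<and> prob_space \<mu> \<and>
         (\<forall>B\<in>sets borel. measure \<mu> (shift -` B) = measure \<mu> B) \<and>
         measure_support \<mu> \<subseteq> K}"

definition entropy_fun :: "real \<Rightarrow> real" where
  "entropy_fun x = (if x = 0 then 0 else - x * ln x)"

definition measure_entropy :: "(nat \<Rightarrow> 'i) measure \<Rightarrow> real" where
  "measure_entropy \<mu> =
     lim (\<lambda>n. 1 / real n * (\<Sum>w\<in>all_words n. entropy_fun (measure \<mu> (cylinder w))))"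

definition energy :: "('i \<Rightarrow> real^'d^'d) \<Rightarrow> real \<Rightarrow> (nat \<Rightarrow> 'i) measure \<Rightarrow> real" where
  "energy A t \<mu> =
     lim (\<lambda>n. 1 / real n *
       (\<Sum>w\<in>all_words n. measure \<mu> (cylinder w) * ln (svf t (word_matrix A w))))"

definition lyap ::
    "('i \<Rightarrow> real^'d^'d) \<Rightarrow> (nat \<Rightarrow> 'i) set \<Rightarrow> nat \<Rightarrow> (nat \<Rightarrow> 'i) measure \<Rightarrow> real" where
  "lyap A K m \<mu> =
     lim (\<lambda>n. 1 / real n *
       (\<Sum>w\<in>words_of K n. measure \<mu> (cylinder w) * ln (sing_val (word_matrix A w) m)))"

definition equilibrium_measure ::
    "('i::{finite, discrete_topology} \<Rightarrow> real^'d^'d) \<Rightarrow> (nat \<Rightarrow> 'i) set \<Rightarrow> real \<Rightarrow>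
     (nat \<Rightarrow> 'i) measure \<Rightarrow> bool" where
  "equilibrium_measure A K t \<mu> \<longleftrightarrow>
     \<mu> \<in> invariant_measures K \<and> pressure A K t = measure_entropy \<mu> + energy A t \<mu>"

end

theory Submission
  imports Defs
begin

text \<open>
  Fix an integer \<open>l\<close> below the dimension. For \<open>t\<close> in \<open>[l, l + 1)\<close> the logarithm of the singular value
  function of a matrix is an affine function of \<open>t\<close> whose slope is the logarithm of the singular value of
  index \<open>l + 1\<close>. Two things follow. Averaging over the words of length \<open>n\<close> with respect to an
  invariant measure and letting \<open>n\<close> grow, the energy is affine in \<open>t\<close> with slope the Lyapunov
  exponent of index \<open>l + 1\<close> (\<open>energy_affine\<close>). And the finite-level pressures are logarithms of sums of
  exponentials of affine functions, hence convex, so the pressure is convex on \<open>(l, l + 1)\<close>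
  (\<open>convex_on_pressure\<close>).

  The Gibbs inequality, used at every finite level, shows that entropy plus energy never exceeds pressure
  (\<open>entropy_plus_energy_le_pressure\<close>). At an equilibrium measure there is equality at \<open>t\<close>, so on
  \<open>(l, l + 1)\<close> the line through the point of the graph over \<open>t\<close> with slope the Lyapunov exponent lies
  below the graph of the pressure: the exponent is a subgradient (\<open>lyap_subgradient\<close>). A
  subgradient of a convex function lies between the one-sided derivatives, and a convex function on an interval
  is differentiable outside a countable set; the exceptional set of the theorem collects these sets for all
  \<open>l\<close>, together with the integers.

  Pressure, entropy, energy and Lyapunov exponents are limits whose existence has to be established. All of
  this comes from Fekete's lemma. The subadditivity that it needs rests on one fact of linear algebra: the
  product of the \<open>k\<close> largest singular values is submultiplicative (\<open>sing_prod_mult_le\<close>). That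
  product is the largest factor by which the matrix expands \<open>k\<close>-dimensional volume. Instead of using
  exterior powers, the expansion factor on a subspace \<open>S\<close> is measured by an ordinary determinant: that of a
  map which agrees with the given one on \<open>S\<close> and carries the orthogonal complement of \<open>S\<close>
  isometrically to the orthogonal complement of the image. Such maps compose, so multiplicativity of the volume
  factor is multiplicativity of the determinant.
\<close>

section \<open>The spectral theorem\<close>

text \<open>
  A maximiser \<open>x\<close> of the quadratic form on the unit sphere of \<open>S\<close> is an eigenvector: with
  maximal value \<open>c\<close>, the form \<open>c (z \<bullet> z) - f z \<bullet> z\<close> is nonnegative on \<open>S\<close> and vanishes at
  \<open>x\<close>, so its derivative at \<open>x\<close> vanishes in the direction \<open>f x - c x\<close>.
\<close>

lemma selfadjoint_eigenvector:
  fixes f :: "'a::euclidean_space \<Rightarrow> 'a"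
  assumes lin: "linear f" and self: "\<And>x y. f x \<bullet> y = x \<bullet> f y"
    and S: "subspace S" "f ` S \<subseteq> S" "dim S > 0"
  obtains x c where "x \<in> S" "norm x = 1" "f x = c *\<^sub>R x"
proof -
  let ?C = "S \<inter> sphere 0 1"
  have "compact ?C"
    by (intro closed_Int_compact closed_subspace S compact_sphere)
  moreover have "?C \<noteq> {}"
  proof -
    obtain z where z: "z \<in> S" "z \<noteq> 0"
      using S(3) by (metis dim_eq_0 less_numeral_extra(3) subsetI singletonI)
    then have "z /\<^sub>R norm z \<in> ?C"
      using S(1) by (simp add: subspace_scale)
    then show ?thesis by blast
  qed
  moreover have "continuous_on ?C (\<lambda>x. f x \<bullet> x)"
    by (intro continuous_intros linear_continuous_on linear_conv_bounded_linear[THEN iffD1] lin)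
  ultimately obtain x where x: "x \<in> ?C" and max: "\<And>y. y \<in> ?C \<Longrightarrow> f y \<bullet> y \<le> f x \<bullet> x"
    using continuous_attains_sup[of ?C "\<lambda>x. f x \<bullet> x"] by blast
  define c where "c = f x \<bullet> x"
  have q: "f z \<bullet> z \<le> c * (z \<bullet> z)" if "z \<in> S" for z
  proof (cases "z = 0")
    case True
    then show ?thesis by simp
  next
    case False
    have "z /\<^sub>R norm z \<in> ?C"
      using S(1) that False by (simp add: subspace_scale)
    from max[OF this] have "(f z \<bullet> z) / (norm z)\<^sup>2 \<le> c"
      by (simp add: c_def linear_cmul[OF lin] power2_eq_square divide_inverse mult_ac)
    then show ?thesis
      using False by (simp add: divide_le_eq dot_square_norm)
  qed
  define y where "y = f x - c *\<^sub>R x"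
  have yS: "y \<in> S"
    using x S by (auto simp: y_def intro!: subspace_diff subspace_scale)
  define D where "D = c * (y \<bullet> y) - f y \<bullet> y"
  have xx: "x \<bullet> x = 1"
    using x by (simp add: dot_square_norm)
  have key: "0 \<le> - 2 * t * (y \<bullet> y) + t\<^sup>2 * D" for t :: real
  proof -
    have "x + t *\<^sub>R y \<in> S"
      using x yS S(1) by (auto intro!: subspace_add subspace_scale)
    from q[OF this]
    have "f x \<bullet> x + 2 * t * (f x \<bullet> y) + t\<^sup>2 * (f y \<bullet> y)
        \<le> c * (x \<bullet> x + 2 * t * (x \<bullet> y) + t\<^sup>2 * (y \<bullet> y))"
      using self[of y x]
      by (simp add: linear_add[OF lin] linear_cmul[OF lin] inner_add inner_commute
          power2_eq_square algebra_simps)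
    moreover have "f x \<bullet> y = y \<bullet> y + c * (x \<bullet> y)"
      by (simp add: y_def inner_diff inner_commute algebra_simps)
    ultimately show ?thesis
      by (simp add: D_def c_def[symmetric] xx algebra_simps)
  qed
  have "y \<bullet> y = 0"
  proof (rule ccontr)
    assume "y \<bullet> y \<noteq> 0"
    then have B: "y \<bullet> y > 0"
      by (simp add: order_less_le)
    \<comment> \<open>small enough for the linear term of \<open>key\<close> to dominate the quadratic one\<close>
    define t where "t = (y \<bullet> y) / (\<bar>D\<bar> + 1)"
    have t: "t > 0" using B by (simp add: t_def)
    have "0 \<le> t * (- 2 * (y \<bullet> y) + t * D)"
      using key[of t] by (simp add: power2_eq_square algebra_simps)
    then have "2 * (y \<bullet> y) \<le> t * D"
      using t by (simp add: zero_le_mult_iff)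
    also have "\<dots> \<le> t * (\<bar>D\<bar> + 1)"
      using t by (intro mult_left_mono) auto
    also have "\<dots> = y \<bullet> y"
      by (simp add: t_def)
    finally show False using B by simp
  qed
  then have "f x = c *\<^sub>R x"
    by (simp add: y_def)
  with x that show thesis by auto
qed

lemma dim_subspace_orthogonal_to_vector:
  fixes S :: "'a::euclidean_space set"
  assumes "subspace S" "x \<in> S" "x \<noteq> 0"
  shows "dim {y \<in> S. x \<bullet> y = 0} + 1 = dim S"
proof -
  have "{y \<in> S. \<forall>z\<in>span {x}. orthogonal z y} = {y \<in> S. x \<bullet> y = 0}"
    by (auto simp: span_singleton orthogonal_def)
  moreover have "dim {y \<in> S. \<forall>z\<in>span {x}. orthogonal z y} + dim (span {x}) = dim S"
    using assms by (intro dim_subspace_orthogonal_to_vectors) (auto simp: span_minimal)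
  ultimately show ?thesis
    using assms by simp
qed

text \<open>
  The spectral theorem, stated for invariant subspaces so that one can split off an eigenvector and pass to
  its orthogonal complement inside \<open>S\<close>.
\<close>

lemma selfadjoint_eigenbasis_subspace:
  fixes f :: "'a::euclidean_space \<Rightarrow> 'a"
  assumes lin: "linear f" and self: "\<And>x y. f x \<bullet> y = x \<bullet> f y"
    and "subspace S" "f ` S \<subseteq> S"
  shows "\<exists>B. finite B \<and> B \<subseteq> S \<and> card B = dim S \<and> pairwise orthogonal B \<and>
           (\<forall>x\<in>B. norm x = 1 \<and> (\<exists>c. f x = c *\<^sub>R x))"
  using assms(3-)
proof (induction "dim S" arbitrary: S)
  case 0
  then show ?case
    by (intro exI[of _ "{}"]) auto
next
  case (Suc n)
  then obtain x c where x: "x \<in> S" "norm x = 1" "f x = c *\<^sub>R x"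
    by (metis selfadjoint_eigenvector[OF lin self] zero_less_Suc)
  define S' where "S' = {y \<in> S. x \<bullet> y = 0}"
  have "x \<noteq> 0" using x by auto
  then have "dim S' = n"
    using dim_subspace_orthogonal_to_vector[of S x] Suc x by (simp add: S'_def)
  moreover have "subspace S'"
    using Suc.prems(1) unfolding S'_def subspace_def by (auto simp: inner_add_right)
  moreover have "f ` S' \<subseteq> S'"
    using Suc.prems(2) x by (auto simp: S'_def self[symmetric])
  ultimately obtain B where B: "finite B" "B \<subseteq> S'" "card B = n" "pairwise orthogonal B"
      "\<forall>x\<in>B. norm x = 1 \<and> (\<exists>c. f x = c *\<^sub>R x)"
    using Suc.hyps(1)[of S'] by auto
  have "x \<notin> B"
    using B(2) x by (auto simp: S'_def dot_square_norm)
  then have "finite (insert x B) \<and> insert x B \<subseteq> S \<and> card (insert x B) = dim S \<and>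
      pairwise orthogonal (insert x B) \<and> (\<forall>x\<in>insert x B. norm x = 1 \<and> (\<exists>c. f x = c *\<^sub>R x))"
    using B x Suc.hyps(2)
    by (auto simp: S'_def pairwise_insert orthogonal_def inner_commute subset_iff)
  then show ?case by blast
qed

lemma inner_matrix_left:
  fixes M :: "real^'n^'m"
  shows "(M *v x) \<bullet> y = x \<bullet> (transpose M *v y)"
  using dot_lmul_matrix[of y M x] by (simp add: inner_commute)

lemma inner_matrix_right:
  fixes M :: "real^'n^'m"
  shows "x \<bullet> (M *v y) = (transpose M *v x) \<bullet> y"
  by (simp add: dot_lmul_matrix)

lemma symmetric_matrix_eigenbasis:
  fixes M :: "real^'d^'d"
  assumes "transpose M = M"
  obtains v :: "'d \<Rightarrow> real^'d" and c :: "'d \<Rightarrow> real"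
    where "\<And>i j. v i \<bullet> v j = (if i = j then 1 else 0)" "\<And>i. M *v v i = c i *\<^sub>R v i"
proof -
  have "\<exists>B. finite B \<and> B \<subseteq> UNIV \<and> card B = dim (UNIV :: (real^'d) set) \<and> pairwise orthogonal B \<and>
           (\<forall>x\<in>B. norm x = 1 \<and> (\<exists>c. M *v x = c *\<^sub>R x))"
    by (rule selfadjoint_eigenbasis_subspace) (use assms in \<open>auto simp: inner_matrix_left\<close>)
  then obtain B where B: "finite B" "card B = CARD('d)" "pairwise orthogonal B"
     "\<And>x. x \<in> B \<Longrightarrow> norm x = 1" "\<And>x. x \<in> B \<Longrightarrow> \<exists>c. M *v x = c *\<^sub>R x"
    by auto
  obtain v where v: "bij_betw v (UNIV :: 'd set) B"
    using finite_same_card_bij[of "UNIV :: 'd set" B] B by auto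
  then have vB: "v i \<in> B" for i
    by (auto simp: bij_betw_def)
  have "v i \<bullet> v j = (if i = j then 1 else 0)" for i j
  proof (cases "i = j")
    case True
    then show ?thesis using B(4) vB by (simp add: dot_square_norm)
  next
    case False
    then have "v i \<noteq> v j" using v by (auto simp: bij_betw_def inj_on_def)
    then show ?thesis using False B(3) vB by (auto simp: pairwise_def orthogonal_def)
  qed
  moreover have "M *v v i = (SOME c. M *v v i = c *\<^sub>R v i) *\<^sub>R v i" for i
    by (rule someI_ex) (use B(5) vB in blast)
  ultimately show thesis by (rule that)
qed

lemma diagonalize_eigenbasis:
  fixes M :: "real^'d^'d" and v :: "'d \<Rightarrow> real^'d"
  assumes v: "\<And>i j. v i \<bullet> v j = (if i = j then 1 else 0)" and c: "\<And>i. M *v v i = c i *\<^sub>R v i"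
  obtains V where "orthogonal_matrix V" "transpose V ** M ** V = (\<chi> i j. if i = j then c i else 0)"
proof -
  define V :: "real^'d^'d" where "V = (\<chi> i j. v j $ i)"
  have col: "V *v axis j 1 = v j" for j
    by (simp add: V_def matrix_vector_mult_basis column_def vec_eq_iff)
  have entry: "X $ i $ j = axis i 1 \<bullet> (X *v axis j 1)" for X :: "real^'d^'d" and i j
    by (simp add: matrix_vector_mult_basis column_def inner_axis' )
  have "orthogonal_matrix V"
    unfolding orthogonal_matrix
    by (auto simp: vec_eq_iff entry[of "transpose V ** V"] mat_def matrix_vector_mul_assoc[symmetric] col
        inner_matrix_right v simp del: transpose_matrix_vector)
  moreover have "transpose V ** M ** V = (\<chi> i j. if i = j then c i else 0)"
    by (auto simp: vec_eq_iff entry[of "transpose V ** M ** V"] matrix_vector_mul_assoc[symmetric] col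
        inner_matrix_right[of _ "transpose V"] v c simp del: transpose_matrix_vector)
  ultimately show thesis using that by blast
qed

lemma det_orthogonal_conjugate:
  fixes V :: "real^'d^'d"
  assumes "orthogonal_matrix V"
  shows "det (transpose V ** M ** V) = det M"
  using det_orthogonal_matrix[OF assms] by (auto simp: det_mul)

lemma det_eigenbasis:
  fixes M :: "real^'d^'d" and v :: "'d \<Rightarrow> real^'d"
  assumes v: "\<And>i j. v i \<bullet> v j = (if i = j then 1 else 0)" and c: "\<And>i. M *v v i = c i *\<^sub>R v i"
  shows "det M = (\<Prod>i\<in>UNIV. c i)"
proof -
  obtain V where V: "orthogonal_matrix V" "transpose V ** M ** V = (\<chi> i j. if i = j then c i else 0)"
    using diagonalize_eigenbasis[OF v c] by blast
  then show ?thesis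
    using det_orthogonal_conjugate[OF V(1), of M] det_diagonal[of "transpose V ** M ** V"] by simp
qed

text \<open>
  Determinants of polynomial matrices can thus be avoided: a real polynomial is determined by its values.
\<close>

lemma poly_charpoly:
  fixes M :: "real^'d^'d"
  shows "poly (charpoly M) x = det (x *\<^sub>R mat 1 - M)"
proof -
  have "poly ((if P then [:0, 1:] else 0) - [:a:]) x = x * (if P then 1 else 0) - a" for P a
    by simp
  then show ?thesis
    by (simp add: charpoly_def det_def poly_sum poly_prod mat_def)
qed

lemma charpoly_eigenbasis:
  fixes M :: "real^'d^'d" and v :: "'d \<Rightarrow> real^'d"
  assumes v: "\<And>i j. v i \<bullet> v j = (if i = j then 1 else 0)" and c: "\<And>i. M *v v i = c i *\<^sub>R v i"
  shows "charpoly M = (\<Prod>i\<in>UNIV. [:- c i, 1:])"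
proof -
  have "poly (charpoly M) x = (\<Prod>i\<in>UNIV. x - c i)" for x
    unfolding poly_charpoly
  proof (rule det_eigenbasis[OF v])
    show "(x *\<^sub>R mat 1 - M) *v v i = (x - c i) *\<^sub>R v i" for i
      by (simp add: matrix_vector_mult_diff_rdistrib c scaleR_matrix_vector_assoc[symmetric] scaleR_diff_left)
  qed
  then show ?thesis
    by (simp add: poly_eq_poly_eq_iff[symmetric] fun_eq_iff poly_prod)
qed

text \<open>
  Links the definition through roots of the characteristic polynomial with an orthonormal eigenbasis.
\<close>

lemma sing_vals_eigenbasis:
  fixes T :: "real^'d^'d" and v :: "'d \<Rightarrow> real^'d"
  assumes v: "\<And>i j. v i \<bullet> v j = (if i = j then 1 else 0)"
    and c: "\<And>i. (transpose T ** T) *v v i = c i *\<^sub>R v i"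
  shows "sing_vals T = rev (sorted_list_of_multiset (image_mset (\<lambda>i. sqrt (c i)) (mset_set UNIV)))"
proof -
  have "proots (\<Prod>i\<in>I. [:- c i, 1:]) = image_mset c (mset_set I)" if "finite I" for I
    using that
    by (induction rule: finite_induct) (auto simp: proots_mult simp del: mult_pCons_left)
  from this[of UNIV] show ?thesis
    by (simp add: sing_vals_def charpoly_eigenbasis[OF v c] image_mset.compositionality o_def)
qed

section \<open>Singular values and singular frames\<close>

text \<open>
  Sorting the eigenvectors by their eigenvalues makes the \<open>i\<close>-th vector belong to the
  \<open>i\<close>-th entry of the sorted list of singular values.
\<close>

lemma singular_vectors:
  fixes T :: "real^'d^'d"
  obtains v :: "nat \<Rightarrow> real^'d"
  where "\<And>i j. i \<in> {1..CARD('d)} \<Longrightarrow> j \<in> {1..CARD('d)} \<Longrightarrow> v i \<bullet> v j = (if i = j then 1 else 0)"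
    and "\<And>i. i \<in> {1..CARD('d)} \<Longrightarrow> (transpose T ** T) *v v i = (sing_val T i)\<^sup>2 *\<^sub>R v i"
    and "\<And>i. i \<in> {1..CARD('d)} \<Longrightarrow> 0 \<le> sing_val T i"
    and "\<And>i j. i \<in> {1..CARD('d)} \<Longrightarrow> j \<in> {1..CARD('d)} \<Longrightarrow> i \<le> j \<Longrightarrow> sing_val T j \<le> sing_val T i"
proof -
  obtain u c where u: "\<And>i j :: 'd. u i \<bullet> u j = (if i = j then 1 else 0 :: real)"
      and c: "\<And>i. (transpose T ** T) *v u i = c i *\<^sub>R u i"
    using symmetric_matrix_eigenbasis[of "transpose T ** T"] by (auto simp: matrix_transpose_mul)
  have c0: "0 \<le> c i" for i
  proof -
    have "c i = ((transpose T ** T) *v u i) \<bullet> u i"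
      by (simp add: c u)
    also have "\<dots> = (T *v u i) \<bullet> (T *v u i)"
      by (simp add: inner_matrix_left matrix_vector_mul_assoc[symmetric] inner_commute
          del: transpose_matrix_vector)
    finally show ?thesis by simp
  qed
  obtain es where es: "distinct es" "set es = (UNIV :: 'd set)"
    using finite_distinct_list[of "UNIV :: 'd set"] by auto
  define f where "f = (\<lambda>i. sqrt (c i))"
  define xs where "xs = rev (sort_key f es)"
  have xs: "distinct xs" "set xs = UNIV" "length xs = CARD('d)"
    using es distinct_card[of es] by (auto simp: xs_def)
  have sort: "sort (map f es) = map f (sort_key f es)"
    by (intro properties_for_sort) auto
  have "mset es = mset_set UNIV"
    using es by (metis mset_set_set)
  then have "image_mset f (mset_set UNIV) = mset (map f es)"
    by simp
  moreover have "sing_vals T = rev (sorted_list_of_multiset (image_mset f (mset_set UNIV)))"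
    unfolding f_def by (rule sing_vals_eigenbasis[OF u c])
  ultimately have "sing_vals T = rev (sort (map f es))"
    by (simp only: sorted_list_of_multiset_mset)
  then have sv: "sing_vals T = map f xs"
    by (simp only: sort xs_def rev_map)
  define v where "v = (\<lambda>i. u (xs ! (i - 1)))"
  have val: "sing_val T i = f (xs ! (i - 1))" if "i \<in> {1..CARD('d)}" for i
    using that xs by (auto simp: sing_val_def sv)
  have "v i \<bullet> v j = (if i = j then 1 else 0)"
    if "i \<in> {1..CARD('d)}" "j \<in> {1..CARD('d)}" for i j
  proof -
    have "i - 1 < length xs" "j - 1 < length xs" "i - 1 = j - 1 \<longleftrightarrow> i = j"
      using that xs(3) by auto
    then show ?thesis
      using nth_eq_iff_index_eq[OF xs(1), of "i - 1" "j - 1"] by (simp add: v_def u)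
  qed
  moreover have "(transpose T ** T) *v v i = (sing_val T i)\<^sup>2 *\<^sub>R v i" if "i \<in> {1..CARD('d)}" for i
    using that c0 by (simp add: val c v_def f_def)
  moreover have "0 \<le> sing_val T i" if "i \<in> {1..CARD('d)}" for i
    using that c0 by (simp add: val f_def)
  moreover have "sing_val T j \<le> sing_val T i"
    if "i \<in> {1..CARD('d)}" "j \<in> {1..CARD('d)}" "i \<le> j" for i j
  proof -
    have "sorted_wrt (\<ge>) (map f xs)"
      by (simp add: xs_def rev_map[symmetric] sorted_wrt_rev)
    then have "\<forall>a b. a \<le> b \<longrightarrow> b < length xs \<longrightarrow> f (xs ! b) \<le> f (xs ! a)"
      by (auto simp: sorted_wrt_iff_nth_less nat_less_le)
    then show ?thesis
      using that xs by (auto simp: val)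
  qed
  ultimately show thesis by (rule that)
qed

text \<open>
  The right singular vectors of \<open>T\<close>, numbered from 1 like the singular values.
\<close>

definition singular_frame :: "real^'d^'d \<Rightarrow> (nat \<Rightarrow> real^'d) \<Rightarrow> bool" where
  "singular_frame T v \<longleftrightarrow>
     (\<forall>i\<in>{1..CARD('d)}. \<forall>j\<in>{1..CARD('d)}. v i \<bullet> v j = (if i = j then 1 else 0)) \<and>
     (\<forall>i\<in>{1..CARD('d)}. (transpose T ** T) *v v i = (sing_val T i)\<^sup>2 *\<^sub>R v i)"

lemma singular_frame_exists:
  obtains v where "singular_frame T v"
proof (rule singular_vectors[of T], goal_cases)
  case (1 v)
  show ?case
    by (rule that[of v]) (unfold singular_frame_def, intro conjI ballI 1)
qed

lemma singular_frameD:
  fixes T :: "real^'d^'d"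
  assumes "singular_frame T v"
  shows "\<And>i j. i \<in> {1..CARD('d)} \<Longrightarrow> j \<in> {1..CARD('d)} \<Longrightarrow> v i \<bullet> v j = (if i = j then 1 else 0)"
    and "\<And>i. i \<in> {1..CARD('d)} \<Longrightarrow> (transpose T ** T) *v v i = (sing_val T i)\<^sup>2 *\<^sub>R v i"
  using assms by (simp_all add: singular_frame_def)

lemma sing_val_nonneg:
  fixes T :: "real^'d^'d"
  assumes "i \<in> {1..CARD('d)}"
  shows "0 \<le> sing_val T i"
  by (rule singular_vectors[of T]) (use assms in blast)

lemma sing_val_antimono:
  fixes T :: "real^'d^'d"
  assumes "i \<in> {1..CARD('d)}" "j \<in> {1..CARD('d)}" "i \<le> j"
  shows "sing_val T j \<le> sing_val T i"
  by (rule singular_vectors[of T]) (use assms in blast)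

lemma det_eigenframe:
  fixes M :: "real^'d^'d" and v :: "nat \<Rightarrow> real^'d"
  assumes v: "\<And>i j. i \<in> {1..CARD('d)} \<Longrightarrow> j \<in> {1..CARD('d)} \<Longrightarrow> v i \<bullet> v j = (if i = j then 1 else 0)"
    and c: "\<And>i. i \<in> {1..CARD('d)} \<Longrightarrow> M *v v i = c i *\<^sub>R v i"
  shows "det M = (\<Prod>i = 1..CARD('d). c i)"
proof -
  obtain e where e: "bij_betw e (UNIV :: 'd set) {1..CARD('d)}"
    using finite_same_card_bij[of "UNIV :: 'd set" "{1..CARD('d)}"] by auto
  then have e': "e i \<in> {1..CARD('d)}" "e i = e j \<longleftrightarrow> i = j" for i j
    by (auto simp: bij_betw_def inj_on_def)
  have "det M = (\<Prod>i\<in>UNIV. c (e i))"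
    by (rule det_eigenbasis[of "\<lambda>i. v (e i)"]) (simp_all only: v c e')
  also have "\<dots> = (\<Prod>i = 1..CARD('d). c i)"
    by (rule prod.reindex_bij_betw[OF e])
  finally show ?thesis .
qed

section \<open>Volume expansion and products of singular values\<close>

text \<open>
  The matrix \<open>X\<close> agrees with \<open>T\<close> on \<open>S\<close> and is an isometry from the orthogonal complement
  of \<open>S\<close> into that of \<open>T S\<close>. Hence \<open>\<bar>det X\<bar>\<close> is the factor by which \<open>T\<close> scales
  volume on \<open>S\<close>; for a \<open>k\<close>-dimensional \<open>S\<close> this replaces the norm of a decomposable
  \<open>k\<close>-vector under the exterior power of \<open>T\<close>.
\<close>

definition perp_isometric_extension ::
    "real^'d^'d \<Rightarrow> (real^'d) set \<Rightarrow> real^'d^'d \<Rightarrow> bool" where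
  "perp_isometric_extension T S X \<longleftrightarrow>
     (\<forall>x\<in>S. X *v x = T *v x) \<and>
     (\<forall>y\<in>S\<^sup>\<bottom>. \<forall>z\<in>S\<^sup>\<bottom>. (X *v y) \<bullet> (X *v z) = y \<bullet> z) \<and>
     (\<forall>x\<in>S. \<forall>y\<in>S\<^sup>\<bottom>. (X *v x) \<bullet> (X *v y) = 0)"

lemma mem_orthogonal_comp: "y \<in> S\<^sup>\<bottom> \<longleftrightarrow> (\<forall>x\<in>S. x \<bullet> y = 0)"
  by (auto simp: orthogonal_comp_def orthogonal_def)

lemma invertible_inj:
  fixes T :: "real^'d^'d"
  assumes "invertible T"
  shows "inj ((*v) T)"
  using assms by (metis inj_on_inverseI invertible_def matrix_left_invertible_injective)

lemma dim_matrix_image: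
  fixes T :: "real^'d^'d"
  assumes "invertible T"
  shows "dim ((*v) T ` S) = dim S"
  by (rule dim_image_eq) (use invertible_inj[OF assms] in \<open>auto intro: inj_on_subset\<close>)

lemma dim_orthogonal_comp:
  fixes S :: "'a::euclidean_space set"
  assumes "subspace S"
  shows "dim (S\<^sup>\<bottom>) + dim S = DIM('a)"
  using dim_subspace_orthogonal_to_vectors[OF assms subspace_UNIV] by (simp add: orthogonal_comp_def)

lemma subspace_decomp:
  fixes S :: "'a::euclidean_space set"
  assumes "subspace S"
  obtains s s' where "s \<in> S" "s' \<in> S\<^sup>\<bottom>" "x = s + s'"
proof -
  obtain y z where "y \<in> span S" "\<And>w. w \<in> span S \<Longrightarrow> orthogonal z w" "x = y + z"
    using orthogonal_subspace_decomp_exists[of S x] by blast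
  then show thesis
    using that[of y z] assms
    by (simp add: mem_orthogonal_comp orthogonal_def inner_commute span_eq_iff[THEN iffD2])
qed

lemma norm_preserving_inner_preserving:
  assumes "linear f" "subspace S" and n: "\<And>x. x \<in> S \<Longrightarrow> norm (f x) = norm x"
    and "y \<in> S" "z \<in> S"
  shows "f y \<bullet> f z = y \<bullet> z"
  using n[of "y + z"] n[of y] n[of z] assms
  by (simp add: dot_norm subspace_add linear_add)

text \<open>
  Since \<open>T\<close> is invertible, the complements of \<open>S\<close> and of \<open>T S\<close> have the same dimension, so
  there is an isometry between them.
\<close>

lemma perp_isometric_extension_exists:
  fixes T :: "real^'d^'d"
  assumes T: "invertible T" and S: "subspace S"
  obtains X where "perp_isometric_extension T S X"
proof -
  let ?TS = "(*v) T ` S"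
  have TS: "subspace ?TS"
    by (intro linear_subspace_image S) auto
  have "dim (S\<^sup>\<bottom>) = dim (?TS\<^sup>\<bottom>)"
    using dim_orthogonal_comp[OF S] dim_orthogonal_comp[OF TS] dim_matrix_image[OF T, of S] by simp
  then obtain f where f: "linear f" "f ` (S\<^sup>\<bottom>) = ?TS\<^sup>\<bottom>"
      "\<And>x. x \<in> S\<^sup>\<bottom> \<Longrightarrow> norm (f x) = norm x"
    by (metis isometries_subspaces subspace_orthogonal_comp)
  obtain B where B: "B \<subseteq> S" "pairwise orthogonal B" "\<And>x. x \<in> B \<Longrightarrow> norm x = 1"
       "independent B" "card B = dim S" "span B = S"
    using orthonormal_basis_subspace[OF S] by metis
  have finB: "finite B" using B(4) independent_imp_finite by blast
  \<comment> \<open>orthogonal projection to \<open>S\<close>\<close>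
  define P where "P x = (\<Sum>b\<in>B. (x \<bullet> b) *\<^sub>R b)" for x
  have linP: "linear P"
    unfolding P_def by (intro linear_compose_sum ballI linearI) (auto simp: inner_add_left scaleR_add_left)
  have P0: "P y = 0" if "y \<in> S\<^sup>\<bottom>" for y
    using that B(1) by (auto simp: P_def mem_orthogonal_comp inner_commute intro!: sum.neutral)
  have PB: "P b = b" if "b \<in> B" for b
  proof -
    have "P b = (\<Sum>a\<in>B. if a = b then b else 0)"
      unfolding P_def using that B(2,3)
      by (intro sum.cong) (auto simp: pairwise_def orthogonal_def dot_square_norm)
    then show ?thesis using that finB by simp
  qed
  have PS: "P x = x" if "x \<in> S" for x
    using that linear_eq_on[OF linP linear_id, of x B] PB B(6) by auto
  define g where "g x = T *v P x + f (x - P x)" for x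
  have "linear g"
    unfolding g_def
    by (intro linear_compose_add linear_compose[OF linP, unfolded o_def] linear_compose[OF _ f(1), unfolded o_def]
        linear_compose_sub linear_ident linP) auto
  then have X: "matrix g *v x = g x" for x
    by (simp add: matrix_works)
  have gS: "g x = T *v x" if "x \<in> S" for x
    using that by (simp add: g_def PS linear_0[OF f(1)])
  have gp: "g y = f y" if "y \<in> S\<^sup>\<bottom>" for y
    using that by (simp add: g_def P0)
  have "perp_isometric_extension T S (matrix g)"
    unfolding perp_isometric_extension_def X
  proof (intro conjI ballI)
    show "g y \<bullet> g z = y \<bullet> z" if "y \<in> S\<^sup>\<bottom>" "z \<in> S\<^sup>\<bottom>" for y z
      using that norm_preserving_inner_preserving[OF f(1) subspace_orthogonal_comp f(3)] by (simp add: gp)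
    show "g x \<bullet> g y = 0" if "x \<in> S" "y \<in> S\<^sup>\<bottom>" for x y
    proof -
      have "f y \<in> ?TS\<^sup>\<bottom>" using f(2) that by blast
      then show ?thesis using that by (simp add: gp gS mem_orthogonal_comp)
    qed
  qed (simp add: gS)
  then show thesis using that by blast
qed

text \<open>
  The chain rule for volume factors. It is the reason for working with this notion.
\<close>

lemma perp_isometric_extension_compose:
  assumes X: "perp_isometric_extension B S X"
    and Y: "perp_isometric_extension A ((*v) B ` S) Y"
  shows "perp_isometric_extension (A ** B) S (Y ** X)"
proof -
  have "X *v y \<in> ((*v) B ` S)\<^sup>\<bottom>" if "y \<in> S\<^sup>\<bottom>" for y
    using X that by (auto simp: perp_isometric_extension_def mem_orthogonal_comp)
  then show ?thesis
    using X Y unfolding perp_isometric_extension_def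
    by (auto simp: matrix_vector_mul_assoc[symmetric])
qed

text \<open>
  The norm of the \<open>k\<close>-th exterior power of \<open>T\<close>.
\<close>

definition sing_prod :: "nat \<Rightarrow> real^'d^'d \<Rightarrow> real" where
  "sing_prod k T = (\<Prod>m = 1..k. sing_val T m)"

text \<open>
  On the span of the top \<open>k\<close> singular vectors the volume factor is exactly the product of the top
  \<open>k\<close> singular values: the whole frame consists of eigenvectors of \<open>X\<^sup>T X\<close>, with eigenvalue the squared
  singular value for the first \<open>k\<close> of them and 1 for the others.
\<close>

lemma det_perp_isometric_extension_top:
  fixes T :: "real^'d^'d" and v :: "nat \<Rightarrow> real^'d"
  assumes frame: "singular_frame T v"
    and k: "k \<le> CARD('d)"
    and X: "perp_isometric_extension T (span (v ` {1..k})) X"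
  shows "(det X)\<^sup>2 = (sing_prod k T)\<^sup>2"
proof -
  note v = singular_frameD(1)[OF frame] and c = singular_frameD(2)[OF frame]
  let ?S = "span (v ` {1..k})"
  have X1: "X *v x = T *v x" if "x \<in> ?S" for x
    using X that unfolding perp_isometric_extension_def by blast
  have X2: "(X *v y) \<bullet> (X *v z) = y \<bullet> z" if "y \<in> ?S\<^sup>\<bottom>" "z \<in> ?S\<^sup>\<bottom>" for y z
    using X that unfolding perp_isometric_extension_def by blast
  have X3: "(X *v x) \<bullet> (X *v y) = 0" if "x \<in> ?S" "y \<in> ?S\<^sup>\<bottom>" for x y
    using X that unfolding perp_isometric_extension_def by blast
  \<comment> \<open>the eigenvalues of \<open>X\<^sup>T X\<close>\<close>
  define a where "a i = (if i \<le> k then (sing_val T i)\<^sup>2 else 1)" for i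
  have "(transpose X ** X) *v v i = a i *\<^sub>R v i" if i: "i \<in> {1..CARD('d)}" for i
  proof (rule vector_eq_rdot[THEN iffD1, rule_format])
    fix y
    obtain s s' where y: "s \<in> ?S" "s' \<in> ?S\<^sup>\<bottom>" "y = s + s'"
      using subspace_decomp[of ?S y] by auto
    have "((transpose X ** X) *v v i) \<bullet> y = (X *v v i) \<bullet> (X *v y)"
      by (simp add: inner_matrix_right matrix_vector_mul_assoc[symmetric])
    also have "\<dots> = (X *v v i) \<bullet> (X *v s) + (X *v v i) \<bullet> (X *v s')"
      by (simp add: y matrix_vector_right_distrib inner_add_right)
    also have "\<dots> = (a i *\<^sub>R v i) \<bullet> y"
    proof (cases "i \<le> k")
      case True
      then have vS: "v i \<in> ?S" using i by (intro span_base) auto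
      then have "(X *v v i) \<bullet> (X *v s) = (T *v v i) \<bullet> (T *v s)"
        using X1 y by simp
      also have "\<dots> = ((transpose T ** T) *v v i) \<bullet> s"
        by (simp add: inner_matrix_right matrix_vector_mul_assoc[symmetric])
      also have "\<dots> = (a i *\<^sub>R v i) \<bullet> s"
        using True by (simp add: c[OF i] a_def)
      finally show ?thesis
        using X3[OF vS y(2)] y vS by (simp add: inner_add_right mem_orthogonal_comp)
    next
      case False
      have vP: "v i \<in> ?S\<^sup>\<bottom>"
      proof -
        have "v ` {1..k} \<subseteq> {x. v i \<bullet> x = 0}"
          using v i k False by auto
        then have "?S \<subseteq> {x. v i \<bullet> x = 0}"
          by (intro span_minimal subspace_hyperplane)
        then show ?thesis by (auto simp: mem_orthogonal_comp inner_commute)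
      qed
      have "(X *v v i) \<bullet> (X *v s) = 0" "(X *v v i) \<bullet> (X *v s') = v i \<bullet> s'" "v i \<bullet> s = 0"
        using X3[OF y(1) vP] X2[OF vP y(2)] y(1) vP
        by (simp_all add: inner_commute[of "X *v s"] inner_commute[of "v i"] mem_orthogonal_comp)
      then show ?thesis
        using False by (simp add: a_def y(3) inner_add_right)
    qed
    finally show "((transpose X ** X) *v v i) \<bullet> y = (a i *\<^sub>R v i) \<bullet> y" .
  qed
  then have "det (transpose X ** X) = (\<Prod>i = 1..CARD('d). a i)"
    by (intro det_eigenframe[OF v])
  also have "\<dots> = (\<Prod>i = 1..k. a i)"
    using k by (intro prod.mono_neutral_right) (auto simp: a_def)
  also have "\<dots> = (sing_prod k T)\<^sup>2"
    by (simp add: a_def sing_prod_def prod_power_distrib)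
  finally show ?thesis
    by (simp add: det_mul power2_eq_square)
qed

text \<open>
  Rotating \<open>n\<close> to a coordinate axis turns \<open>Y\<close> into the identity matrix with one column
  replaced, whose determinant Cramer's rule gives.
\<close>

lemma det_rank_one_update:
  fixes a n :: "real^'d"
  assumes "norm n = 1" and Y: "\<And>x. Y *v x = x + (n \<bullet> x) *\<^sub>R a"
  shows "det Y = 1 + n \<bullet> a"
proof -
  fix k :: 'd
  obtain Q :: "real^'d^'d" where Q: "orthogonal_matrix Q" "Q *v axis k 1 = n"
    using orthogonal_matrix_exists_basis[OF assms(1)] by blast
  define b where "b = transpose Q *v a"
  have QQ: "transpose Q *v (Q *v x) = x" for x
    using Q(1) by (simp add: orthogonal_matrix matrix_vector_mul_assoc del: transpose_matrix_vector)
  define Z where "Z = transpose Q ** Y ** Q"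
  have Z: "Z *v x = x + (x $ k) *\<^sub>R b" for x
  proof -
    have "n \<bullet> (Q *v x) = axis k 1 \<bullet> (transpose Q *v (Q *v x))"
      unfolding Q(2)[symmetric] by (rule inner_matrix_left)
    also have "\<dots> = x $ k"
      by (simp add: QQ inner_axis' del: transpose_matrix_vector)
    finally have "n \<bullet> (Q *v x) = x $ k" .
    then show ?thesis
      by (simp add: Z_def matrix_vector_mul_assoc[symmetric] Y b_def matrix_vector_right_distrib QQ
         matrix_vector_mult_scaleR del: transpose_matrix_vector)
  qed
  have ent: "Z $ i $ j = axis j 1 $ i + axis j 1 $ k * b $ i" for i j
  proof -
    have "Z $ i $ j = (Z *v axis j 1) $ i"
      by (simp add: matrix_vector_mult_basis column_def)
    then show ?thesis by (simp add: Z)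
  qed
  have sum_rows: "(\<Sum>j\<in>UNIV. u $ j *s row j (mat 1)) = u" for u :: "real^'d"
    by (simp add: vec_eq_iff row_def mat_def if_distrib cong: if_cong)
  have tr: "transpose Z = (\<chi> i. if i = k then \<Sum>j\<in>UNIV. (axis k 1 + b) $ j *s row j (mat 1) else row i (mat 1))"
    unfolding sum_rows by (auto simp: vec_eq_iff transpose_def ent axis_def row_def mat_def)
  have "det Y = det Z"
    by (simp add: Z_def det_orthogonal_conjugate[OF Q(1)])
  also have "\<dots> = det (transpose Z)"
    by (rule det_transpose[symmetric])
  also have "\<dots> = (axis k 1 + b) $ k * det (mat 1 :: real^'d^'d)"
    unfolding tr by (rule cramer_lemma_transpose)
  also have "\<dots> = 1 + b $ k"
    by simp
  also have "b $ k = axis k 1 \<bullet> b"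
    by (simp add: inner_axis')
  also have "axis k 1 \<bullet> b = n \<bullet> a"
    unfolding b_def Q(2)[symmetric] by (rule inner_matrix_left[symmetric])
  finally show ?thesis .
qed

lemma orthonormal_family:
  assumes "\<And>i j. i \<in> I \<Longrightarrow> j \<in> I \<Longrightarrow> v i \<bullet> v j = (if i = j then 1 else 0 :: real)"
  shows "inj_on v I" and "independent (v ` I)"
proof -
  show "inj_on v I"
  proof (rule inj_onI)
    fix i j assume "i \<in> I" "j \<in> I" "v i = v j"
    then show "i = j" using assms[of i j] assms[of i i] by (simp split: if_splits)
  qed
  show "independent (v ` I)"
  proof (rule pairwise_orthogonal_independent)
    show "pairwise orthogonal (v ` I)"
      by (auto simp: pairwise_def orthogonal_def assms)
    have "v i \<noteq> 0" if "i \<in> I" for i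
      using assms[OF that that] by auto
    then show "0 \<notin> v ` I" by auto
  qed
qed

text \<open>
  Expand \<open>u\<close> in the singular frame: only the singular values from index \<open>k + 1\<close> on occur.
\<close>

lemma norm_le_sing_val:
  fixes T :: "real^'d^'d" and v :: "nat \<Rightarrow> real^'d"
  assumes frame: "singular_frame T v"
    and k: "k < CARD('d)" and u: "\<And>i. i \<in> {1..k} \<Longrightarrow> u \<bullet> v i = 0"
  shows "norm (T *v u) \<le> sing_val T (Suc k) * norm u"
proof -
  note v = singular_frameD(1)[OF frame] and c = singular_frameD(2)[OF frame]
  let ?I = "{1..CARD('d)}"
  have inj: "inj_on v ?I" and "independent (v ` ?I)"
    using orthonormal_family[of ?I v] v by auto
  moreover have "card (v ` ?I) = DIM(real^'d)"
    using card_image[OF inj] by simp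
  ultimately have "u \<in> span (v ` ?I)"
    by (metis UNIV_I card_ge_dim_independent dim_UNIV order_refl subsetD subset_UNIV)
  then obtain r where "u = (\<Sum>x\<in>v ` ?I. r x *\<^sub>R x)"
    by (auto simp: span_finite)
  then have u1: "u = (\<Sum>i\<in>?I. r (v i) *\<^sub>R v i)"
    by (simp only: sum.reindex[OF inj] o_def)
  define q where "q i = r (v i)" for i
  have uq: "u = (\<Sum>i\<in>?I. q i *\<^sub>R v i)"
    using u1 by (simp add: q_def)
  have uv: "u \<bullet> v j = q j" if "j \<in> ?I" for j
  proof -
    have "u \<bullet> v j = (\<Sum>i\<in>?I. q i * (if i = j then 1 else 0))"
      unfolding uq inner_sum_left using that by (intro sum.cong) (simp_all only: inner_scaleR_left v)
    then show ?thesis using that by (simp add: if_distrib cong: if_cong)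
  qed
  have nu: "(norm u)\<^sup>2 = (\<Sum>i\<in>?I. (q i)\<^sup>2)"
  proof -
    have "u \<bullet> u = (\<Sum>i\<in>?I. q i * (u \<bullet> v i))"
      by (subst (2) uq) (simp only: inner_sum_right inner_scaleR_right)
    then show ?thesis by (simp add: dot_square_norm uv power2_eq_square)
  qed
  have MU: "(transpose T ** T) *v u = (\<Sum>i\<in>?I. (q i * (sing_val T i)\<^sup>2) *\<^sub>R v i)"
    by (subst uq) (simp add: matrix_vector_mult_scaleR c linear_sum[OF matrix_vector_mul_linear])
  have "(norm (T *v u))\<^sup>2 = u \<bullet> ((transpose T ** T) *v u)"
    by (simp add: inner_matrix_left matrix_vector_mul_assoc[symmetric] flip: dot_square_norm
          del: transpose_matrix_vector)
  also have "\<dots> = (\<Sum>i\<in>?I. (q i * (sing_val T i)\<^sup>2) * (u \<bullet> v i))"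
    by (simp only: MU inner_sum_right inner_scaleR_right)
  also have "\<dots> \<le> (\<Sum>i\<in>?I. (sing_val T (Suc k))\<^sup>2 * (q i)\<^sup>2)"
  proof (rule sum_mono)
    fix i assume i: "i \<in> ?I"
    show "(q i * (sing_val T i)\<^sup>2) * (u \<bullet> v i) \<le> (sing_val T (Suc k))\<^sup>2 * (q i)\<^sup>2"
    proof (cases "i \<le> k")
      case True
      then show ?thesis using u[of i] i by simp
    next
      case False
      then have "(sing_val T i)\<^sup>2 \<le> (sing_val T (Suc k))\<^sup>2"
        using i k by (intro power_mono sing_val_antimono sing_val_nonneg) auto
      then have "(q i)\<^sup>2 * (sing_val T i)\<^sup>2 \<le> (q i)\<^sup>2 * (sing_val T (Suc k))\<^sup>2"
        by (intro mult_left_mono) auto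
      then show ?thesis using i by (simp add: uv power2_eq_square mult_ac)
    qed
  qed
  also have "\<dots> = (sing_val T (Suc k) * norm u)\<^sup>2"
    by (simp add: nu sum_distrib_left power_mult_distrib)
  finally show ?thesis
    using sing_val_nonneg[of "Suc k", where T = T] k by (intro power2_le_imp_le[of "norm (T *v u)"]) auto
qed

text \<open>
  The projection to the span of \<open>B\<close> cannot be injective on \<open>S\<close> for dimension reasons.
\<close>

lemma subspace_meets_codim:
  fixes S :: "'a::euclidean_space set"
  assumes "subspace S" "finite B" "card B < dim S"
  obtains u where "u \<in> S" "norm u = 1" "\<And>b. b \<in> B \<Longrightarrow> u \<bullet> b = 0"
proof -
  define P where "P x = (\<Sum>b\<in>B. (x \<bullet> b) *\<^sub>R b)" for x
  have lin: "linear P"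
    unfolding P_def by (intro linear_compose_sum ballI linearI) (auto simp: inner_add_left scaleR_add_left)
  have "P ` S \<subseteq> span B"
    by (rule image_subsetI) (unfold P_def, rule span_sum, rule span_scale, rule span_base)
  then have "dim (P ` S) \<le> card B"
    using assms(2) by (meson dim_le_card)
  then have "\<not> inj_on P (span S)"
    using dim_image_eq[OF lin, of S] assms(3) by auto
  then obtain x where x: "x \<in> S" "P x = 0" "x \<noteq> 0"
    using linear_inj_on_iff_eq_0[OF lin subspace_span, of S] assms(1)
    by (metis span_eq_iff)
  have "0 = x \<bullet> P x" using x by simp
  also have "\<dots> = (\<Sum>b\<in>B. (x \<bullet> b)\<^sup>2)"
    by (simp add: P_def inner_sum_right power2_eq_square)
  finally have "x \<bullet> b = 0" if "b \<in> B" for b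
    using that assms(2) sum_nonneg_eq_0_iff[of B "\<lambda>b. (x \<bullet> b)\<^sup>2"] by simp
  then show thesis
    using x assms(1) by (intro that[of "x /\<^sub>R norm x"]) (auto intro: subspace_scale)
qed

text \<open>
  No subspace does better than the span of the top singular vectors. By induction on the dimension
  \<open>k + 1\<close> of \<open>S\<close>: a unit vector \<open>u\<close> of \<open>S\<close> orthogonal to the first \<open>k\<close> singular vectors is
  stretched at most by the singular value of index \<open>k + 1\<close>. Let \<open>X'\<close> agree with \<open>X\<close> on the
  complement of \<open>u\<close> but send \<open>u\<close> to a unit normal of the image of that complement. Then \<open>X'\<close> is an
  admissible map for the part of \<open>S\<close> orthogonal to \<open>u\<close>, and \<open>X\<close> is a rank one update of
  \<open>X'\<close> that changes the determinant at most by the factor \<open>norm (X u)\<close>.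
\<close>

lemma det_perp_isometric_extension_le:
  fixes T :: "real^'d^'d"
  assumes "subspace S" "perp_isometric_extension T S X"
  shows "\<bar>det X\<bar> \<le> sing_prod (dim S) T"
  using assms
proof (induction "dim S" arbitrary: S X)
  case 0
  then have "S = {0}" by (metis dim_eq_0 subset_singletonD subspace_0 empty_iff)
  then have "norm (X *v y) = norm y" for y
    using 0(3) by (simp add: perp_isometric_extension_def norm_eq_sqrt_inner)
  then have "orthogonal_transformation ((*v) X)"
    by (simp add: orthogonal_transformation)
  then have "\<bar>det X\<bar> = 1"
    using orthogonal_transformation_det[of "(*v) X"] by simp
  then show ?case
    using 0(1) by (simp add: sing_prod_def)
next
  case (Suc k)
  note S = \<open>subspace S\<close>
  have X1: "X *v x = T *v x" if "x \<in> S" for x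
    using Suc.prems(2) that unfolding perp_isometric_extension_def by blast
  have X2: "(X *v y) \<bullet> (X *v z) = y \<bullet> z" if "y \<in> S\<^sup>\<bottom>" "z \<in> S\<^sup>\<bottom>" for y z
    using Suc.prems(2) that unfolding perp_isometric_extension_def by blast
  have X3: "(X *v x) \<bullet> (X *v y) = 0" if "x \<in> S" "y \<in> S\<^sup>\<bottom>" for x y
    using Suc.prems(2) that unfolding perp_isometric_extension_def by blast
  have k: "k < CARD('d)"
    using Suc.hyps(2) dim_subset_UNIV[of S] by simp
  obtain v where v: "singular_frame T v"
    by (rule singular_frame_exists)
  have "card (v ` {1..k}) \<le> k"
    using card_image_le[of "{1..k}" v] by simp
  then obtain u where u: "u \<in> S" "norm u = 1" "\<And>i. i \<in> {1..k} \<Longrightarrow> u \<bullet> v i = 0"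
  proof -
    assume "card (v ` {1..k}) \<le> k"
    then have "card (v ` {1..k}) < dim S" using Suc.hyps(2) by simp
    then obtain w where w: "w \<in> S" "norm w = 1" "\<And>b. b \<in> v ` {1..k} \<Longrightarrow> w \<bullet> b = 0"
      using subspace_meets_codim[OF S, of "v ` {1..k}"] by blast
    show thesis by (rule that[of w]) (use w in auto)
  qed
  have Xu: "norm (X *v u) \<le> sing_val T (Suc k)"
    using norm_le_sing_val[OF v k u(3)] u by (simp add: X1)
  have uu: "u \<bullet> u = 1" "u \<noteq> 0"
    using u(2) by (auto simp: dot_square_norm)
  define H where "H = {x. u \<bullet> x = 0}"
  have "dim H = CARD('d) - 1"
    using dim_hyperplane[OF uu(2)] by (simp add: H_def)
  then have "dim ((*v) X ` H) < CARD('d)"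
    using dim_image_le[of "(*v) X" H] k by simp
  then obtain n where n: "norm n = 1" "\<And>x. u \<bullet> x = 0 \<Longrightarrow> n \<bullet> (X *v x) = 0"
  proof -
    assume *: "dim ((*v) X ` H) < CARD('d)"
    obtain z where z: "z \<noteq> 0" "\<And>y. y \<in> span ((*v) X ` H) \<Longrightarrow> orthogonal z y"
      using orthogonal_to_subspace_exists[of "(*v) X ` H"] * by auto
    have "z \<bullet> (X *v x) = 0" if "u \<bullet> x = 0" for x
      using z(2)[of "X *v x"] that by (auto simp: H_def orthogonal_def intro: span_base)
    then show thesis
      using z(1) that[of "z /\<^sub>R norm z"] by simp
  qed
  define S' where "S' = {x \<in> S. u \<bullet> x = 0}"
  have S': "subspace S'"
    using S unfolding S'_def subspace_def by (auto simp: inner_add_right)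
  have dS': "k = dim S'"
    using dim_subspace_orthogonal_to_vector[OF S u(1) uu(2)] Suc.hyps(2) by (simp add: S'_def)
  \<comment> \<open>the map \<open>X'\<close>: equal to \<open>X\<close> on the complement of \<open>u\<close>, and \<open>u \<mapsto> n\<close>\<close>
  define g where "g x = X *v x + (u \<bullet> x) *\<^sub>R (n - X *v u)" for x
  have "linear g"
    unfolding g_def by (intro linearI) (auto simp: matrix_vector_right_distrib inner_add_right
      algebra_simps matrix_vector_mult_scaleR)
  define X' where "X' = matrix g"
  have X': "X' *v x = X *v x + (u \<bullet> x) *\<^sub>R (n - X *v u)" for x
    using \<open>linear g\<close> by (simp add: X'_def matrix_works g_def)
  have decomp: "\<exists>z. y = (u \<bullet> y) *\<^sub>R u + z \<and> z \<in> S\<^sup>\<bottom> \<and> u \<bullet> z = 0 \<and> X' *v y = (u \<bullet> y) *\<^sub>R n + X *v z"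
    if y: "y \<in> S'\<^sup>\<bottom>" for y
  proof (intro exI[of _ "y - (u \<bullet> y) *\<^sub>R u"] conjI)
    show "y - (u \<bullet> y) *\<^sub>R u \<in> S\<^sup>\<bottom>"
      unfolding mem_orthogonal_comp
    proof
      fix x assume x: "x \<in> S"
      have "x - (u \<bullet> x) *\<^sub>R u \<in> S'"
        using x u S by (auto simp: S'_def inner_diff_right uu intro!: subspace_diff subspace_scale)
      then have "(x - (u \<bullet> x) *\<^sub>R u) \<bullet> y = 0"
        using y by (simp add: mem_orthogonal_comp)
      then show "x \<bullet> (y - (u \<bullet> y) *\<^sub>R u) = 0"
        by (simp add: inner_diff_left inner_diff_right inner_commute algebra_simps)
    qed
    show "u \<bullet> (y - (u \<bullet> y) *\<^sub>R u) = 0"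
      by (simp add: inner_diff_right uu)
    show "X' *v y = (u \<bullet> y) *\<^sub>R n + X *v (y - (u \<bullet> y) *\<^sub>R u)"
      by (simp add: X' matrix_vector_mult_diff_distrib matrix_vector_mult_scaleR algebra_simps)
  qed simp
  have "perp_isometric_extension T S' X'"
    unfolding perp_isometric_extension_def
  proof (intro conjI ballI)
    show "X' *v x = T *v x" if "x \<in> S'" for x
      using that by (simp add: S'_def X' X1)
  next
    fix y z assume "y \<in> S'\<^sup>\<bottom>" "z \<in> S'\<^sup>\<bottom>"
    obtain y' where y': "y = (u \<bullet> y) *\<^sub>R u + y'" "y' \<in> S\<^sup>\<bottom>" "u \<bullet> y' = 0" "X' *v y = (u \<bullet> y) *\<^sub>R n + X *v y'"
      using decomp[OF \<open>y \<in> S'\<^sup>\<bottom>\<close>] by blast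
    obtain z' where z': "z = (u \<bullet> z) *\<^sub>R u + z'" "z' \<in> S\<^sup>\<bottom>" "u \<bullet> z' = 0" "X' *v z = (u \<bullet> z) *\<^sub>R n + X *v z'"
      using decomp[OF \<open>z \<in> S'\<^sup>\<bottom>\<close>] by blast
    have "y \<bullet> z = ((u \<bullet> y) *\<^sub>R u + y') \<bullet> ((u \<bullet> z) *\<^sub>R u + z')"
      using y'(1) z'(1) by simp
    also have "\<dots> = (u \<bullet> y) * (u \<bullet> z) + y' \<bullet> z'"
      using y'(3) z'(3) uu(1) by (simp add: inner_add_left inner_add_right inner_commute[of y' u])
    finally have yz: "y \<bullet> z = (u \<bullet> y) * (u \<bullet> z) + y' \<bullet> z'" .
    show "(X' *v y) \<bullet> (X' *v z) = y \<bullet> z"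
      unfolding yz y'(4) z'(4)
      using n(1) n(2)[OF y'(3)] n(2)[OF z'(3)] X2[OF y'(2) z'(2)]
      by (simp add: inner_add_left inner_add_right inner_commute[of "X *v y'" n] dot_square_norm)
  next
    fix x y assume x: "x \<in> S'" and "y \<in> S'\<^sup>\<bottom>"
    obtain y' where y': "y' \<in> S\<^sup>\<bottom>" "X' *v y = (u \<bullet> y) *\<^sub>R n + X *v y'"
      using decomp[OF \<open>y \<in> S'\<^sup>\<bottom>\<close>] by blast
    then show "(X' *v x) \<bullet> (X' *v y) = 0"
      using x n(2)[of x] X3[of x y'] by (simp add: S'_def X' inner_add_right inner_commute)
  qed
  then have IH: "\<bar>det X'\<bar> \<le> sing_prod k T"
    using Suc.hyps(1)[OF dS' S'] dS' by simp
  \<comment> \<open>the rank one update with \<open>n \<mapsto> X u\<close> that turns \<open>X'\<close> into \<open>X\<close>\<close>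
  define Y :: "real^'d^'d" where "Y = matrix (\<lambda>x. x + (n \<bullet> x) *\<^sub>R (X *v u - n))"
  have Y: "Y *v x = x + (n \<bullet> x) *\<^sub>R (X *v u - n)" for x
  proof -
    have "linear (\<lambda>x. x + (n \<bullet> x) *\<^sub>R (X *v u - n))"
      by (intro linearI) (auto simp: inner_add_right algebra_simps)
    then show ?thesis by (simp add: Y_def matrix_works)
  qed
  have "Y ** X' = X"
  proof (rule matrix_eq[THEN iffD2, rule_format])
    fix x
    have "n \<bullet> (X' *v x) = u \<bullet> x"
      using n(2)[of "x - (u \<bullet> x) *\<^sub>R u"] n(1) uu
      by (simp add: X' inner_add_right inner_diff_right matrix_vector_mult_diff_distrib
          matrix_vector_mult_scaleR dot_square_norm algebra_simps)
    then show "(Y ** X') *v x = X *v x"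
      by (simp add: matrix_vector_mul_assoc[symmetric] Y) (simp add: X' algebra_simps)
  qed
  then have "\<bar>det X\<bar> = \<bar>det Y\<bar> * \<bar>det X'\<bar>"
    by (metis det_mul abs_mult)
  also have "det Y = n \<bullet> (X *v u)"
    using det_rank_one_update[OF n(1) Y] n(1) by (simp add: inner_diff_right dot_square_norm)
  also have "\<bar>n \<bullet> (X *v u)\<bar> * \<bar>det X'\<bar> \<le> sing_val T (Suc k) * sing_prod k T"
    using Cauchy_Schwarz_ineq2[of n "X *v u"] Xu n(1) IH sing_val_nonneg[of "Suc k", where T = T] k
    by (intro mult_mono) auto
  also have "\<dots> = sing_prod (dim S) T"
    by (simp add: Suc.hyps(2)[symmetric] sing_prod_def)
  finally show ?case .
qed

text \<open>
  Choose \<open>S\<close> optimal for \<open>A ** B\<close>. Its volume factor is that of \<open>B\<close> on \<open>S\<close> times that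
  of \<open>A\<close> on \<open>B S\<close>, and each of these is at most the corresponding product of singular values.
\<close>

lemma sing_prod_mult_le:
  fixes A B :: "real^'d^'d"
  assumes A: "invertible A" and B: "invertible B" and k: "k \<le> CARD('d)"
  shows "sing_prod k (A ** B) \<le> sing_prod k A * sing_prod k B"
proof -
  obtain v where v: "singular_frame (A ** B) v"
    by (rule singular_frame_exists)
  let ?S = "span (v ` {1..k})"
  have inj: "inj_on v {1..k}" and "independent (v ` {1..k})"
    using orthonormal_family[of "{1..k}" v] singular_frameD(1)[OF v] k by auto
  then have dS: "dim ?S = k"
    using card_image[OF inj] by (simp add: dim_eq_card_independent)
  obtain X where X: "perp_isometric_extension B ?S X"
    using perp_isometric_extension_exists[OF B subspace_span] by blast
  have BS: "subspace ((*v) B ` ?S)"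
    by (intro linear_subspace_image subspace_span) auto
  obtain Y where Y: "perp_isometric_extension A ((*v) B ` ?S) Y"
    using perp_isometric_extension_exists[OF A BS] by blast
  have "(det (Y ** X))\<^sup>2 = (sing_prod k (A ** B))\<^sup>2"
    by (rule det_perp_isometric_extension_top[OF v k perp_isometric_extension_compose[OF X Y]])
  then have "\<bar>det (Y ** X)\<bar> = \<bar>sing_prod k (A ** B)\<bar>"
    by (auto simp: power2_eq_iff)
  then have "sing_prod k (A ** B) \<le> \<bar>det Y\<bar> * \<bar>det X\<bar>"
    by (simp add: det_mul abs_mult)
  also have "\<dots> \<le> sing_prod k A * sing_prod k B"
    using det_perp_isometric_extension_le[OF BS Y] det_perp_isometric_extension_le[OF subspace_span X]
      dim_matrix_image[OF B, of ?S] dS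
    by (intro mult_mono) (auto intro: order_trans[OF abs_ge_zero])
  finally show ?thesis .
qed

lemma sing_val_pos:
  fixes T :: "real^'d^'d"
  assumes T: "invertible T" and i: "i \<in> {1..CARD('d)}"
  shows "0 < sing_val T i"
proof -
  obtain v where v: "singular_frame T v"
    by (rule singular_frame_exists)
  have "(T *v v i) \<bullet> (T *v v i) = ((transpose T ** T) *v v i) \<bullet> v i"
    by (simp add: inner_matrix_right matrix_vector_mul_assoc[symmetric])
  also have "\<dots> = (sing_val T i)\<^sup>2"
    using i by (simp add: singular_frameD[OF v])
  finally have "sing_val T i \<noteq> 0"
    using inj_onD[OF invertible_inj[OF T], of "v i" 0] singular_frameD(1)[OF v i i] by auto
  with sing_val_nonneg[OF i, of T] show ?thesis by simp
qed

lemma sing_val_mat_1: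
  assumes i: "i \<in> {1..CARD('d)}"
  shows "sing_val (mat 1 :: real^'d^'d) i = 1"
proof -
  obtain v where v: "singular_frame (mat 1 :: real^'d^'d) v"
    by (rule singular_frame_exists)
  have "v i \<bullet> v i = (sing_val (mat 1 :: real^'d^'d) i)\<^sup>2 * (v i \<bullet> v i)"
    using arg_cong[OF singular_frameD(2)[OF v i], of "\<lambda>x. x \<bullet> v i"] by simp
  then have "(sing_val (mat 1 :: real^'d^'d) i)\<^sup>2 = 1"
    using singular_frameD(1)[OF v i i] by simp
  with sing_val_nonneg[OF i, of "mat 1"] show ?thesis by (simp add: power2_eq_1_iff)
qed

section \<open>Fekete's lemma and the Gibbs inequality\<close>

text \<open>
  Fekete's lemma. Write \<open>n = q m + r\<close> for a length \<open>m\<close> at which \<open>u m / m\<close> is close to the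
  infimum.
\<close>

lemma fekete:
  fixes u :: "nat \<Rightarrow> real"
  assumes sub: "\<And>m n. u (m + n) \<le> u m + u n" and low: "\<And>n. - C * real n \<le> u n"
  shows "convergent (\<lambda>n. 1 / real n * u n)"
proof -
  define L where "L = (INF n\<in>{1..}. u n / real n)"
  have bdd: "bdd_below ((\<lambda>n. u n / real n) ` {1..})"
    using low by (intro bdd_belowI[of _ "- C"]) (auto simp: field_simps)
  have L: "L \<le> u n / real n" if "n \<ge> 1" for n
    unfolding L_def using bdd that by (intro cINF_lower) auto
  have mult: "u (q * m + r) \<le> real q * u m + u r" for q m r
  proof (induction q)
    case (Suc q)
    have "u (Suc q * m + r) \<le> u m + u (q * m + r)"
      using sub[of m "q * m + r"] by (simp add: add.assoc)
    with Suc show ?case by (simp add: algebra_simps)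
  qed simp
  have "(\<lambda>n. 1 / real n * u n) \<longlonglongrightarrow> L"
  proof (rule LIMSEQ_I)
    fix e :: real assume e: "e > 0"
    have "\<exists>m\<in>{1..}. u m / real m < L + e / 2"
      using e bdd unfolding L_def by (subst cINF_less_iff[symmetric]) auto
    then obtain m where m: "m \<ge> 1" "u m / real m < L + e / 2" by auto
    define B where "B = (\<Sum>r<m. \<bar>u r\<bar>) + \<bar>u m\<bar>"
    have "(\<lambda>n. B / real n) \<longlonglongrightarrow> 0"
      by (rule lim_const_over_n)
    then have "\<forall>\<^sub>F n in sequentially. B / real n < e / 2"
      using e by (intro order_tendstoD) auto
    then obtain N where N: "\<And>n. n \<ge> N \<Longrightarrow> B / real n < e / 2"
      by (auto simp: eventually_sequentially)
    show "\<exists>no. \<forall>n\<ge>no. norm (1 / real n * u n - L) < e"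
    proof (intro exI[of _ "max 1 N"] allI impI)
      fix n assume n: "n \<ge> max 1 N"
      define q r where "q = n div m" and "r = n mod m"
      have nqr: "n = q * m + r" and r: "r < m"
        using m by (auto simp: q_def r_def)
      have "\<bar>u r\<bar> \<le> (\<Sum>r<m. \<bar>u r\<bar>)"
        using r by (intro member_le_sum) auto
      have "real q * u m + (real r / real m) * u m = real n * (u m / real m)"
        using m by (simp add: nqr field_simps)
      moreover have "- (real r / real m) * u m \<le> \<bar>u m\<bar>"
      proof -
        have "- (real r / real m) * u m \<le> \<bar>- (real r / real m) * u m\<bar>"
          by (rule abs_ge_self)
        also have "\<dots> \<le> 1 * \<bar>u m\<bar>"
          unfolding abs_mult using r by (intro mult_right_mono) auto
        finally show ?thesis by simp
      qed
      moreover have "u n \<le> real q * u m + u r"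
        using mult[of q m r] by (simp add: nqr)
      ultimately have "u n \<le> real n * (u m / real m) + B"
        using \<open>\<bar>u r\<bar> \<le> _\<close> by (simp add: B_def)
      then have "u n / real n \<le> (real n * (u m / real m) + B) / real n"
        by (intro divide_right_mono) auto
      also have "\<dots> = u m / real m + B / real n"
        using n by (simp add: field_simps)
      also have "\<dots> < L + e"
        using m(2) N[of n] n by linarith
      finally have "u n / real n < L + e" .
      moreover have "L \<le> u n / real n"
        using L[of n] n by linarith
      ultimately have "\<bar>u n / real n - L\<bar> < e"
        by linarith
      then show "norm (1 / real n * u n - L) < e"
        by simp
    qed
  qed
  then show ?thesis by (rule convergentI)
qed

text \<open>
  Summand by summand this is \<open>ln x \<le> x - 1\<close> at \<open>x = z w / (p w * sum z S)\<close>. It is used three times: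
  for convexity of log-sum-exp, for subadditivity of entropy, and for the bound of entropy plus
  energy by pressure.
\<close>

lemma gibbs_inequality:
  fixes p z :: "'a \<Rightarrow> real"
  assumes "finite S" and p: "\<And>w. w \<in> S \<Longrightarrow> 0 \<le> p w" "sum p S = 1"
    and z: "\<And>w. w \<in> S \<Longrightarrow> 0 \<le> z w" "\<And>w. w \<in> S \<Longrightarrow> p w > 0 \<Longrightarrow> z w > 0"
  shows "(\<Sum>w\<in>S. entropy_fun (p w) + p w * ln (z w)) \<le> ln (sum z S)"
proof -
  have "\<exists>w\<in>S. p w > 0"
  proof (rule ccontr)
    assume "\<not> ?thesis"
    then have "sum p S = 0" using p(1) by (intro sum.neutral) force
    with p(2) show False by simp
  qed
  then have Z: "sum z S > 0"
    using z \<open>finite S\<close> by (metis sum_pos2)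
  have "entropy_fun (p w) + p w * ln (z w) \<le> p w * ln (sum z S) + (z w / sum z S - p w)"
    if w: "w \<in> S" for w
  proof (cases "p w = 0")
    case True
    then show ?thesis using Z z(1)[OF w] by (simp add: entropy_fun_def)
  next
    case False
    then have pw: "p w > 0" "z w > 0" using p(1)[OF w] z(2)[OF w] by auto
    have "ln (z w / (p w * sum z S)) \<le> z w / (p w * sum z S) - 1"
      using pw Z by (intro ln_le_minus_one) simp
    then have "p w * ln (z w / (p w * sum z S)) \<le> p w * (z w / (p w * sum z S) - 1)"
      using pw by (intro mult_left_mono) auto
    also have "p w * (z w / (p w * sum z S) - 1) = z w / sum z S - p w"
      using pw Z by (simp add: field_simps)
    finally show ?thesis
      using pw Z by (simp add: entropy_fun_def ln_div ln_mult algebra_simps)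
  qed
  then have "(\<Sum>w\<in>S. entropy_fun (p w) + p w * ln (z w)) \<le>
      (\<Sum>w\<in>S. p w * ln (sum z S) + (z w / sum z S - p w))"
    by (intro sum_mono)
  also have "\<dots> = sum p S * ln (sum z S) + (sum z S / sum z S - sum p S)"
    by (simp only: sum.distrib sum_subtractf sum_distrib_right[symmetric] sum_divide_distrib[symmetric])
  also have "\<dots> = ln (sum z S)"
    using p(2) Z by simp
  finally show ?thesis .
qed

text \<open>
  The Gibbs weights at \<open>x\<close> turn the Gibbs inequality into an equality at \<open>x\<close>, so they provide a
  supporting line there.
\<close>

lemma convex_on_log_sum_exp:
  fixes a b :: "'a \<Rightarrow> real"
  assumes S: "finite S" "S \<noteq> {}"
  shows "convex_on UNIV (\<lambda>s. ln (\<Sum>w\<in>S. exp (a w + b w * s)))"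
proof -
  define Z where "Z s = (\<Sum>w\<in>S. exp (a w + b w * s))" for s
  define p where "p x w = exp (a w + b w * x) / Z x" for x w
  have Z: "Z s > 0" for s
    unfolding Z_def using S by (intro sum_pos) auto
  have p1: "(\<Sum>w\<in>S. p x w) = 1" for x
    using Z[of x] by (simp add: p_def sum_divide_distrib[symmetric] Z_def[symmetric])
  have "convex_on UNIV (\<lambda>s. ln (Z s))"
  proof (rule pos_convex_function[where f' = "\<lambda>x. \<Sum>w\<in>S. p x w * b w"])
    fix x y :: real
    have "(\<Sum>w\<in>S. entropy_fun (p x w) + p x w * ln (exp (a w + b w * y))) \<le> ln (Z y)"
      unfolding Z_def
      using S p1[of x] Z[of x] by (intro gibbs_inequality) (auto simp: p_def)
    also have "(\<Sum>w\<in>S. entropy_fun (p x w) + p x w * ln (exp (a w + b w * y)))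
       = (\<Sum>w\<in>S. p x w * ln (Z x) + p x w * b w * (y - x))"
    proof (rule sum.cong)
      fix w
      have pw: "p x w > 0" using Z[of x] by (simp add: p_def)
      have lnp: "ln (p x w) = a w + b w * x - ln (Z x)"
        using Z[of x] by (simp add: p_def ln_div)
      show "entropy_fun (p x w) + p x w * ln (exp (a w + b w * y)) =
           p x w * ln (Z x) + p x w * b w * (y - x)"
        using pw by (simp add: entropy_fun_def lnp) (simp add: algebra_simps)
    qed simp
    also have "\<dots> = ln (Z x) + (\<Sum>w\<in>S. p x w * b w) * (y - x)"
      by (simp add: sum.distrib sum_distrib_right[symmetric] p1)
    finally show "(\<Sum>w\<in>S. p x w * b w) * (y - x) \<le> ln (Z y) - ln (Z x)"
      by simp
  qed simp
  then show ?thesis by (simp add: Z_def)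
qed

section \<open>One-sided derivatives of convex functions\<close>

text \<open>
  The limit is the infimum of the values.
\<close>

lemma mono_bounded_limit_at_right_0:
  fixes q :: "real \<Rightarrow> real"
  assumes e: "0 < e" and mono: "\<And>x y. 0 < x \<Longrightarrow> x \<le> y \<Longrightarrow> y < e \<Longrightarrow> q x \<le> q y"
    and bdd: "\<And>x. 0 < x \<Longrightarrow> x < e \<Longrightarrow> B \<le> q x"
  shows "\<exists>r. (q \<longlongrightarrow> r) (at_right 0) \<and> B \<le> r \<and> (\<forall>x. 0 < x \<and> x < e \<longrightarrow> r \<le> q x)"
proof -
  define r where "r = (INF x\<in>{0<..<e}. q x)"
  have bb: "bdd_below (q ` {0<..<e})"
    using bdd by (intro bdd_belowI[of _ B]) auto
  have lower: "r \<le> q x" if "0 < x" "x < e" for x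
    unfolding r_def using bb that by (intro cINF_lower) auto
  have "B \<le> r"
    unfolding r_def using bdd e by (intro cINF_greatest) auto
  moreover have "(q \<longlongrightarrow> r) (at_right 0)"
  proof (rule order_tendstoI)
    fix c assume "c < r"
    then show "\<forall>\<^sub>F x in at_right 0. c < q x"
      using lower e unfolding eventually_at_right_field by (intro exI[of _ e]) force
  next
    fix c assume "r < c"
    then have "\<exists>x\<in>{0<..<e}. q x < c"
      using e bb unfolding r_def by (subst cINF_less_iff[symmetric]) auto
    then obtain x where x: "0 < x" "x < e" "q x < c" by auto
    have "q y < c" if "0 < y" "y < x" for y
      using mono[of y x] that x by linarith
    with x show "\<forall>\<^sub>F x in at_right 0. q x < c"
      unfolding eventually_at_right_field by blast
  qed
  ultimately show ?thesis using lower by blast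
qed

abbreviation (input) diff_quot :: "(real \<Rightarrow> real) \<Rightarrow> real \<Rightarrow> real \<Rightarrow> real" where
  "diff_quot f t \<equiv> (\<lambda>\<delta>. (f (t + \<delta>) - f t) / \<delta>)"

lemma convex_on_diff_quot_mono:
  fixes f :: "real \<Rightarrow> real"
  assumes f: "convex_on {a<..<b} f" and t: "t \<in> {a<..<b}"
    and "x \<noteq> 0" "y \<noteq> 0" "x \<le> y" "t + x \<in> {a<..<b}" "t + y \<in> {a<..<b}"
  shows "diff_quot f t x \<le> diff_quot f t y"
proof -
  consider "x = y" | "0 < x" "x < y" | "x < 0" "0 < y" | "x < y" "y < 0"
    using assms(3-5) by linarith
  then show ?thesis
  proof cases
    case 2
    then show ?thesis
      using convex_on_slope_le(1)[OF f t assms(7), of "t + x"]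
      by (simp add: divide_simps split: if_splits) (simp add: algebra_simps)
  next
    case 3
    then show ?thesis
      using convex_on_slope_le[OF f assms(6,7), of t]
      by (simp add: divide_simps split: if_splits) (simp add: algebra_simps)
  next
    case 4
    then show ?thesis
      using convex_on_slope_le(2)[OF f assms(6) t, of "t + y"] by simp
  qed simp
qed

text \<open>
  Difference quotients of a convex function are monotone, so they converge from either side, and every secant slope
  to the right of \<open>t\<close> is at least the right derivative, every one to the left at most the left derivative.
\<close>

lemma convex_on_one_sided_derivatives:
  fixes f :: "real \<Rightarrow> real"
  assumes f: "convex_on {a<..<b} f" and t: "t \<in> {a<..<b}"
  shows "\<exists>Dl Dr. (diff_quot f t \<longlongrightarrow> Dl) (at_left 0) \<and> (diff_quot f t \<longlongrightarrow> Dr) (at_right 0) \<and> Dl \<le> Dr \<and>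
    (\<forall>s\<in>{a<..<b}. t < s \<longrightarrow> Dr \<le> (f s - f t) / (s - t)) \<and>
    (\<forall>s\<in>{a<..<b}. s < t \<longrightarrow> (f s - f t) / (s - t) \<le> Dl)"
proof -
  define e where "e = min (b - t) (t - a)"
  have e: "e > 0" using t by (simp add: e_def)
  note mono = convex_on_diff_quot_mono[OF f t]
  have mono_r: "diff_quot f t x \<le> diff_quot f t y" if "0 < x" "x \<le> y" "y < b - t" for x y
    using that t by (intro mono) auto
  have mono_l: "- diff_quot f t (- x) \<le> - diff_quot f t (- y)" if "0 < x" "x \<le> y" "y < t - a" for x y
    unfolding neg_le_iff_le by (rule mono) (use that t in auto)
  have cross: "diff_quot f t (- x) \<le> diff_quot f t y" if "0 < x" "x < t - a" "0 < y" "y < b - t" for x y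
    using that t by (intro mono) auto
  have neg: "- diff_quot f t (e / 2) \<le> - diff_quot f t (- x)" if "0 < x" "x < t - a" for x
    unfolding neg_le_iff_le by (rule cross) (use that e in \<open>auto simp: e_def\<close>)
  have ta: "0 < t - a" and tb: "0 < b - t" using t by auto
  from mono_bounded_limit_at_right_0[where q = "\<lambda>x. - diff_quot f t (- x)", OF ta mono_l neg]
  obtain Dl' where Dl': "((\<lambda>x. - diff_quot f t (- x)) \<longlongrightarrow> Dl') (at_right 0)"
     "\<And>x. 0 < x \<Longrightarrow> x < t - a \<Longrightarrow> Dl' \<le> - diff_quot f t (- x)"
    by blast
  have up: "- Dl' \<le> diff_quot f t y" if "0 < y" "y < b - t" for y
  proof -
    have "- diff_quot f t y \<le> - diff_quot f t (- x)" if "0 < x" "x < t - a" for x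
      unfolding neg_le_iff_le using that \<open>0 < y\<close> \<open>y < b - t\<close> by (rule cross)
    then have "\<forall>\<^sub>F x in at_right 0. - diff_quot f t y \<le> - diff_quot f t (- x)"
      using t unfolding eventually_at_right_field by (intro exI[of _ "t - a"]) simp
    with Dl'(1) have "- diff_quot f t y \<le> Dl'"
      by (rule tendsto_lowerbound) simp
    then show ?thesis by simp
  qed
  from mono_bounded_limit_at_right_0[where q = "diff_quot f t", OF tb mono_r up]
  obtain Dr where Dr: "(diff_quot f t \<longlongrightarrow> Dr) (at_right 0)" "- Dl' \<le> Dr"
     "\<And>x. 0 < x \<Longrightarrow> x < b - t \<Longrightarrow> Dr \<le> diff_quot f t x"
    by blast
  have "((\<lambda>x. - (- diff_quot f t (- x))) \<longlongrightarrow> - Dl') (at_right 0)"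
    by (rule tendsto_minus[OF Dl'(1)])
  then have "(diff_quot f t \<longlongrightarrow> - Dl') (at_left 0)"
    by (simp add: filterlim_at_left_to_right)
  moreover have "(f s - f t) / (s - t) \<le> - Dl'" if "s \<in> {a<..<b}" "s < t" for s
    using Dl'(2)[of "t - s"] that by (simp add: divide_simps split: if_splits)
  moreover have "Dr \<le> (f s - f t) / (s - t)" if "s \<in> {a<..<b}" "t < s" for s
    using Dr(3)[of "s - t"] that by simp
  ultimately show ?thesis
    using Dr(1,2) by blast
qed

lemma subgradient_between_one_sided_derivatives:
  fixes f :: "real \<Rightarrow> real"
  assumes t: "t \<in> {a<..<b}" and sub: "\<And>s. s \<in> {a<..<b} \<Longrightarrow> f t + m * (s - t) \<le> f s"
    and "(diff_quot f t \<longlongrightarrow> Dl) (at_left 0)" "(diff_quot f t \<longlongrightarrow> Dr) (at_right 0)"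
  shows "Dl \<le> m" "m \<le> Dr"
proof -
  have "\<forall>\<^sub>F \<delta> in at_left 0. diff_quot f t \<delta> \<le> m"
    unfolding eventually_at_left_field
  proof (intro exI[of _ "a - t"] conjI allI impI)
    fix x assume "a - t < x" "x < 0"
    with sub[of "t + x"] t show "diff_quot f t x \<le> m" by (simp add: divide_simps)
  qed (use t in auto)
  then show "Dl \<le> m"
    by (intro tendsto_upperbound[OF assms(3)]) auto
  have "\<forall>\<^sub>F \<delta> in at_right 0. m \<le> diff_quot f t \<delta>"
    unfolding eventually_at_right_field
  proof (intro exI[of _ "b - t"] conjI allI impI)
    fix x assume "0 < x" "x < b - t"
    with sub[of "t + x"] t show "m \<le> diff_quot f t x" by (simp add: divide_simps)
  qed (use t in auto)
  then show "m \<le> Dr"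
    by (intro tendsto_lowerbound[OF assms(4)]) auto
qed

lemma subgradient_eq_derivative:
  fixes f :: "real \<Rightarrow> real"
  assumes "t \<in> {a<..<b}" "\<And>s. s \<in> {a<..<b} \<Longrightarrow> f t + m * (s - t) \<le> f s"
    and "(f has_real_derivative D) (at t)"
  shows "D = m"
proof -
  have "(diff_quot f t \<longlongrightarrow> D) (at_left 0)" "(diff_quot f t \<longlongrightarrow> D) (at_right 0)"
    using assms(3) by (auto simp: DERIV_def filterlim_at_split)
  from subgradient_between_one_sided_derivatives[where f = f and m = m, OF assms(1,2) this] show ?thesis
    by (rule antisym)
qed

text \<open>
  At a kink there is a rational number strictly between the left and the right derivative. Distinct kinks
  get distinct rationals, because the slope of the secant joining them separates the two gaps.
\<close>

lemma convex_on_countable_nondifferentiable: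
  fixes f :: "real \<Rightarrow> real"
  assumes f: "convex_on {a<..<b} f"
  shows "countable {t \<in> {a<..<b}. \<not> (\<exists>D. (f has_real_derivative D) (at t))}" (is "countable ?C")
proof -
  have "\<exists>q\<in>\<rat>. (\<forall>s\<in>{a<..<b}. t < s \<longrightarrow> q < (f s - f t) / (s - t)) \<and>
          (\<forall>s\<in>{a<..<b}. s < t \<longrightarrow> (f s - f t) / (s - t) < q)" if "t \<in> ?C" for t
  proof -
    have t: "t \<in> {a<..<b}" using that by simp
    obtain Dl Dr where D: "(diff_quot f t \<longlongrightarrow> Dl) (at_left 0)" "(diff_quot f t \<longlongrightarrow> Dr) (at_right 0)"
      "Dl \<le> Dr"
      "\<And>s. s \<in> {a<..<b} \<Longrightarrow> t < s \<Longrightarrow> Dr \<le> (f s - f t) / (s - t)"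
      "\<And>s. s \<in> {a<..<b} \<Longrightarrow> s < t \<Longrightarrow> (f s - f t) / (s - t) \<le> Dl"
      using convex_on_one_sided_derivatives[OF f t] by blast
    have "Dl \<noteq> Dr"
      using D(1,2) that by (auto simp: DERIV_def filterlim_at_split)
    then obtain q where "q \<in> \<rat>" "Dl < q" "q < Dr"
      using D(3) Rats_dense_in_real[of Dl Dr] by auto
    then show ?thesis
      by (intro bexI[of _ q] conjI ballI impI)
        (erule (1) less_le_trans[OF _ D(4)] le_less_trans[OF D(5)] | assumption)+
  qed
  then have "\<forall>t\<in>?C. \<exists>q. q \<in> \<rat> \<and> (\<forall>s\<in>{a<..<b}. t < s \<longrightarrow> q < (f s - f t) / (s - t)) \<and>
          (\<forall>s\<in>{a<..<b}. s < t \<longrightarrow> (f s - f t) / (s - t) < q)"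
    by blast
  from bchoice[OF this] obtain q where q:
    "\<forall>t\<in>?C. q t \<in> \<rat> \<and> (\<forall>s\<in>{a<..<b}. t < s \<longrightarrow> q t < (f s - f t) / (s - t)) \<and>
          (\<forall>s\<in>{a<..<b}. s < t \<longrightarrow> (f s - f t) / (s - t) < q t)" ..
  have less: "q t < q s" if "t \<in> ?C" "s \<in> ?C" "t < s" for t s
  proof -
    have "q t < (f s - f t) / (s - t)"
      using q that by blast
    also have "\<dots> = (f t - f s) / (t - s)"
      by (metis minus_diff_eq minus_divide_divide)
    also have "\<dots> < q s"
      using q that by blast
    finally show ?thesis .
  qed
  have "inj_on q ?C"
  proof (rule inj_onI)
    fix t s assume ts: "t \<in> ?C" "s \<in> ?C" "q t = q s"
    show "t = s"
      using less[OF ts(1,2)] less[OF ts(2,1)] ts(3) by (cases t s rule: linorder_cases) simp_all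
  qed
  moreover have "countable (q ` ?C)"
    by (rule countable_subset[OF _ countable_rat]) (use q in blast)
  ultimately show ?thesis
    by (rule countable_image_inj_on[rotated])
qed

section \<open>The singular value function\<close>

text \<open>
  Such functions give subadditive potentials on words; the normalisation at the identity matrix yields, through
  inverses, a lower bound as well.
\<close>

definition log_submult :: "(real^'d^'d \<Rightarrow> real) \<Rightarrow> bool" where
  "log_submult G \<longleftrightarrow> G (mat 1) = 0 \<and>
     (\<forall>A B. invertible A \<longrightarrow> invertible B \<longrightarrow> G (A ** B) \<le> G A + G B)"

lemma sing_prod_pos:
  fixes T :: "real^'d^'d"
  assumes "invertible T" "k \<le> CARD('d)"
  shows "0 < sing_prod k T"
  unfolding sing_prod_def using assms by (intro prod_pos sing_val_pos) auto

lemma ln_sing_val: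
  fixes T :: "real^'d^'d"
  assumes "invertible T" "k < CARD('d)"
  shows "ln (sing_val T (Suc k)) = ln (sing_prod (Suc k) T) - ln (sing_prod k T)"
proof -
  have "sing_prod (Suc k) T = sing_prod k T * sing_val T (Suc k)"
    by (simp add: sing_prod_def)
  then show ?thesis
    using sing_prod_pos[OF assms(1), of k] sing_val_pos[OF assms(1), of "Suc k"] assms(2)
    by (simp add: ln_mult)
qed

lemma log_submult_sing_prod:
  assumes k: "k \<le> CARD('d)"
  shows "log_submult (\<lambda>T :: real^'d^'d. ln (sing_prod k T))"
  unfolding log_submult_def
proof (intro conjI allI impI)
  have "sing_prod k (mat 1 :: real^'d^'d) = 1"
    unfolding sing_prod_def using k by (intro prod.neutral ballI sing_val_mat_1) auto
  then show "ln (sing_prod k (mat 1 :: real^'d^'d)) = 0" by simp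
next
  fix A B :: "real^'d^'d" assume AB: "invertible A" "invertible B"
  have "ln (sing_prod k (A ** B)) \<le> ln (sing_prod k A * sing_prod k B)"
    using AB k by (intro ln_mono sing_prod_mult_le sing_prod_pos invertible_mult)
  then show "ln (sing_prod k (A ** B)) \<le> ln (sing_prod k A) + ln (sing_prod k B)"
    using sing_prod_pos[OF AB(1) k] sing_prod_pos[OF AB(2) k] by (simp add: ln_mult)
qed

text \<open>
  On one cell \<open>[l, l + 1)\<close> the exponent is affine in \<open>t\<close>; the convexity of the pressure and the affine
  dependence of the energy on the parameter both come from this form.
\<close>

lemma svf_eq_exp:
  fixes T :: "real^'d^'d"
  assumes T: "invertible T" and t: "real l \<le> t" "t < real l + 1" and l: "l < CARD('d)"
  shows "svf t T = exp (ln (sing_prod l T) + (t - real l) * ln (sing_val T (Suc l)))"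
proof -
  have "nat \<lfloor>t\<rfloor> = l"
    using t by linarith
  moreover have "t < real CARD('d)"
    using t l by linarith
  ultimately have "svf t T = sing_prod l T * sing_val T (Suc l) powr (t - real l)"
    by (simp add: svf_def sing_prod_def)
  then show ?thesis
    using sing_prod_pos[OF T, of l] sing_val_pos[OF T, of "Suc l"] l
    by (simp add: exp_add powr_def)
qed

text \<open>
  A convex combination of logarithms of two consecutive \<open>sing_prod\<close>, and so log-submultiplicative.
\<close>

lemma ln_svf:
  fixes T :: "real^'d^'d"
  assumes T: "invertible T" and t: "real l \<le> t" "t < real l + 1" and l: "l < CARD('d)"
  shows "ln (svf t T) =
    (1 - (t - real l)) * ln (sing_prod l T) + (t - real l) * ln (sing_prod (Suc l) T)"
  unfolding svf_eq_exp[OF assms] ln_exp ln_sing_val[OF T l] by (simp add: algebra_simps)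

lemma svf_pos:
  fixes T :: "real^'d^'d"
  assumes T: "invertible T" and t: "real l \<le> t" "t < real l + 1" and l: "l < CARD('d)"
  shows "0 < svf t T"
  unfolding svf_eq_exp[OF assms] by simp

lemma log_submult_svf:
  assumes t: "real l \<le> t" "t < real l + 1" and l: "l < CARD('d)"
  shows "log_submult (\<lambda>T :: real^'d^'d. ln (svf t T))"
  unfolding log_submult_def
proof (intro conjI allI impI)
  note P = log_submult_sing_prod[of l, where 'd = 'd] log_submult_sing_prod[of "Suc l", where 'd = 'd]
  have inv1: "invertible (mat 1 :: real^'d^'d)"
    by (auto simp: invertible_def intro!: exI[of _ "mat 1"])
  show "ln (svf t (mat 1 :: real^'d^'d)) = 0"
    using P l by (simp add: ln_svf[OF inv1 t l] log_submult_def)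
  fix A B :: "real^'d^'d" assume AB: "invertible A" "invertible B"
  have "(1 - (t - real l)) * ln (sing_prod l (A ** B))
      \<le> (1 - (t - real l)) * (ln (sing_prod l A) + ln (sing_prod l B))"
    using P AB l t by (intro mult_left_mono) (auto simp: log_submult_def)
  moreover have "(t - real l) * ln (sing_prod (Suc l) (A ** B))
      \<le> (t - real l) * (ln (sing_prod (Suc l) A) + ln (sing_prod (Suc l) B))"
    using P AB l t by (intro mult_left_mono) (auto simp: log_submult_def)
  ultimately show "ln (svf t (A ** B)) \<le> ln (svf t A) + ln (svf t B)"
    using AB by (simp add: ln_svf[OF _ t l] invertible_mult algebra_simps)
qed

section \<open>Matrix products along words\<close>

lemma word_matrix_Nil [simp]: "word_matrix A [] = mat 1"
  and word_matrix_Cons [simp]: "word_matrix A (i # w) = A i ** word_matrix A w"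
  by (simp_all add: word_matrix_def)

lemma word_matrix_append: "word_matrix A (u @ v) = word_matrix A u ** word_matrix A v"
  by (induction u) (simp_all add: matrix_mul_assoc)

lemma invertible_word_matrix:
  fixes A :: "'i \<Rightarrow> real^'d^'d"
  assumes "\<And>i. invertible (A i)"
  shows "invertible (word_matrix A w)"
proof (induction w)
  case Nil
  show ?case by (auto simp: invertible_def intro!: exI[of _ "mat 1"])
qed (simp add: assms invertible_mult)

text \<open>
  Submultiplicativity applied to \<open>A\<^sub>i\<^sup>-\<^sup>1 (A\<^sub>i A\<^sub>w) = A\<^sub>w\<close> bounds the loss caused by one more
  letter.
\<close>

lemma log_submult_lower_bound:
  fixes A :: "'i::finite \<Rightarrow> real^'d^'d"
  assumes A: "\<And>i. invertible (A i)" and G: "log_submult G"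
  shows "\<exists>C. \<forall>w. - C * real (length w) \<le> G (word_matrix A w)"
proof -
  have "\<forall>i. \<exists>B. B ** A i = mat 1 \<and> A i ** B = mat 1"
    using A unfolding invertible_def by blast
  from choice[OF this] obtain B where B: "\<And>i. B i ** A i = mat 1" "\<And>i. A i ** B i = mat 1"
    by blast
  define C where "C = (\<Sum>i\<in>UNIV. \<bar>G (B i)\<bar>)"
  have "- C * real (length w) \<le> G (word_matrix A w)" for w
  proof (induction w)
    case Nil
    then show ?case using G by (simp add: log_submult_def)
  next
    case (Cons i w)
    have inv: "B i ** A i = mat 1" "invertible (B i)"
      using B[of i] by (auto simp: invertible_def)
    have "\<bar>G (B i)\<bar> \<le> C"
      unfolding C_def by (rule member_le_sum) auto
    have "G (word_matrix A w) = G (B i ** word_matrix A (i # w))"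
      by (simp add: matrix_mul_assoc inv)
    also have "\<dots> \<le> G (B i) + G (word_matrix A (i # w))"
      using G inv invertible_word_matrix[of A, OF A] unfolding log_submult_def by blast
    also have "\<dots> \<le> C + G (word_matrix A (i # w))"
      using \<open>\<bar>G (B i)\<bar> \<le> C\<close> by linarith
    finally show ?case using Cons by (simp add: algebra_simps)
  qed
  then show ?thesis by blast
qed

lemma finite_all_words [simp]: "finite (all_words n :: 'i::finite list set)"
  using finite_lists_length_eq[of "UNIV :: 'i set" n] by (simp add: all_words_def)

lemma all_words_0 [simp]: "all_words 0 = {[]}"
  by (auto simp: all_words_def)

lemma sum_all_words_Suc:
  fixes F :: "'i::finite list \<Rightarrow> real"
  shows "(\<Sum>w\<in>all_words (Suc n). F w) = (\<Sum>i\<in>UNIV. \<Sum>w\<in>all_words n. F (i # w))"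
proof -
  have "all_words (Suc n) = (\<lambda>(i, w). i # w) ` (UNIV \<times> (all_words n :: 'i list set))"
    by (auto simp: all_words_def length_Suc_conv)
  moreover have "inj_on (\<lambda>(i, w). i # w) (UNIV \<times> (all_words n :: 'i list set))"
    by (auto simp: inj_on_def)
  ultimately show ?thesis
    by (simp add: sum.reindex sum.cartesian_product case_prod_unfold)
qed

lemma sum_all_words_add:
  fixes F :: "'i::finite list \<Rightarrow> real"
  shows "(\<Sum>w\<in>all_words (m + n). F w) = (\<Sum>u\<in>all_words m. \<Sum>v\<in>all_words n. F (u @ v))"
  by (induction m arbitrary: F) (simp_all add: sum_all_words_Suc)

section \<open>Stationary weights on words\<close>

text \<open>
  What remains of an invariant probability measure on sequences when only its values on cylinders are kept:
  the two sum conditions are additivity (extend a word on the right) and invariance (extend it on the left).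
\<close>

definition stationary :: "('i::finite list \<Rightarrow> real) \<Rightarrow> bool" where
  "stationary f \<longleftrightarrow> (\<forall>w. 0 \<le> f w) \<and> f [] = 1 \<and>
     (\<forall>w. (\<Sum>i\<in>UNIV. f (w @ [i])) = f w) \<and> (\<forall>w. (\<Sum>i\<in>UNIV. f (i # w)) = f w)"

lemma stationary_sum_right:
  assumes f: "stationary f"
  shows "(\<Sum>v\<in>all_words n. f (u @ v)) = f u"
proof (induction n arbitrary: u)
  case (Suc n)
  have "(\<Sum>v\<in>all_words (Suc n). f (u @ v)) = (\<Sum>i\<in>UNIV. \<Sum>v\<in>all_words n. f ((u @ [i]) @ v))"
    by (simp add: sum_all_words_Suc)
  also have "\<dots> = (\<Sum>i\<in>UNIV. f (u @ [i]))"
    by (simp only: Suc)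
  finally show ?case using f by (simp add: stationary_def)
qed simp

lemma stationary_sum_left:
  assumes f: "stationary f"
  shows "(\<Sum>u\<in>all_words n. f (u @ v)) = f v"
proof (induction n)
  case (Suc n)
  have "(\<Sum>u\<in>all_words (Suc n). f (u @ v)) = (\<Sum>u\<in>all_words n. \<Sum>i\<in>UNIV. f (i # (u @ v)))"
    by (simp add: sum_all_words_Suc sum.swap[of _ UNIV])
  also have "\<dots> = (\<Sum>u\<in>all_words n. f (u @ v))"
    using f by (simp add: stationary_def)
  finally show ?case using Suc by simp
qed simp

lemma stationary_sum_1:
  assumes f: "stationary f"
  shows "(\<Sum>w\<in>all_words n. f w) = 1"
  using stationary_sum_right[OF f, of "[]"] f by (simp add: stationary_def)

lemma stationary_le_1:
  assumes f: "stationary f"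
  shows "f w \<le> 1"
proof -
  have "f w \<le> (\<Sum>w\<in>all_words (length w). f w)"
    by (rule member_le_sum) (use f in \<open>simp_all add: stationary_def\<close>, simp add: all_words_def)
  then show ?thesis by (simp add: stationary_sum_1[OF f])
qed

lemma stationary_average_subadditive:
  assumes f: "stationary f" and g: "\<And>u v. g (u @ v) \<le> g u + g v"
  shows "(\<Sum>w\<in>all_words (m + n). f w * g w) \<le>
           (\<Sum>w\<in>all_words m. f w * g w) + (\<Sum>w\<in>all_words n. f w * g w)"
proof -
  have "(\<Sum>w\<in>all_words (m + n). f w * g w)
      \<le> (\<Sum>u\<in>all_words m. \<Sum>v\<in>all_words n. f (u @ v) * (g u + g v))"
    unfolding sum_all_words_add
    using f g by (intro sum_mono mult_left_mono) (auto simp: stationary_def)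
  also have "\<dots> = (\<Sum>u\<in>all_words m. \<Sum>v\<in>all_words n. f (u @ v) * g u)
       + (\<Sum>u\<in>all_words m. \<Sum>v\<in>all_words n. f (u @ v) * g v)"
    by (simp add: distrib_left sum.distrib)
  also have "(\<Sum>u\<in>all_words m. \<Sum>v\<in>all_words n. f (u @ v) * g v)
      = (\<Sum>v\<in>all_words n. \<Sum>u\<in>all_words m. f (u @ v) * g v)"
    by (rule sum.swap)
  finally show ?thesis
    by (simp add: sum_distrib_right[symmetric] stationary_sum_left[OF f] stationary_sum_right[OF f])
qed

lemma convergent_stationary_average:
  fixes A :: "'i::finite \<Rightarrow> real^'d^'d"
  assumes f: "stationary f" and A: "\<And>i. invertible (A i)" and G: "log_submult G"
  shows "convergent (\<lambda>n. 1 / real n * (\<Sum>w\<in>all_words n. f w * G (word_matrix A w)))"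
proof -
  obtain C where C: "\<And>w. - C * real (length w) \<le> G (word_matrix A w)"
    using log_submult_lower_bound[of A G] A G by blast
  show ?thesis
  proof (rule fekete)
    have "G (word_matrix A (u @ v)) \<le> G (word_matrix A u) + G (word_matrix A v)" for u v
      using G invertible_word_matrix[of A, OF A] unfolding log_submult_def word_matrix_append by blast
    then show "(\<Sum>w\<in>all_words (m + n). f w * G (word_matrix A w)) \<le>
           (\<Sum>w\<in>all_words m. f w * G (word_matrix A w)) + (\<Sum>w\<in>all_words n. f w * G (word_matrix A w))" for m n
      by (rule stationary_average_subadditive[OF f])
    show "- C * real n \<le> (\<Sum>w\<in>all_words n. f w * G (word_matrix A w))" for n
    proof -
      have "- C * real n = (\<Sum>w\<in>all_words n. f w * (- C * real n))"
        by (simp only: sum_distrib_right[symmetric] stationary_sum_1[OF f] mult_1_left)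
      also have "\<dots> \<le> (\<Sum>w\<in>all_words n. f w * G (word_matrix A w))"
        using f C by (intro sum_mono mult_left_mono) (auto simp: stationary_def all_words_def)
      finally show ?thesis .
    qed
  qed
qed

text \<open>
  Subadditivity of entropy: the Gibbs inequality for the joint distribution of a prefix and a suffix against
  the product of their marginals.
\<close>

lemma convergent_entropy:
  assumes f: "stationary f"
  shows "convergent (\<lambda>n. 1 / real n * (\<Sum>w\<in>all_words n. entropy_fun (f w)))"
proof (rule fekete[where C = 0])
  have f0: "0 \<le> f w" for w using f by (simp add: stationary_def)
  show "- 0 * real n \<le> (\<Sum>w\<in>all_words n. entropy_fun (f w))" for n
    using f0 stationary_le_1[OF f]
    by (auto intro!: sum_nonneg simp: entropy_fun_def mult_nonneg_nonpos order_less_le)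
  fix m n
  \<comment> \<open>the product of the marginals is positive wherever the joint distribution is\<close>
  have pos: "0 < f u" "0 < f v" if "0 < f (u @ v)" "u \<in> all_words m" "v \<in> all_words n" for u v
  proof -
    have "f (u @ v) \<le> (\<Sum>v\<in>all_words n. f (u @ v))" "f (u @ v) \<le> (\<Sum>u\<in>all_words m. f (u @ v))"
      by (rule member_le_sum, use that f0 in auto)+
    with that show "0 < f u" "0 < f v"
      by (simp_all add: stationary_sum_left[OF f] stationary_sum_right[OF f])
  qed
  let ?S = "all_words m \<times> all_words n :: ('a list \<times> 'a list) set"
  have "(\<Sum>p\<in>?S. entropy_fun (f (fst p @ snd p)) + f (fst p @ snd p) * ln (f (fst p) * f (snd p)))
     \<le> ln (\<Sum>p\<in>?S. f (fst p) * f (snd p))"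
  proof (rule gibbs_inequality)
    have "(\<Sum>p\<in>?S. f (fst p @ snd p)) = (\<Sum>w\<in>all_words (m + n). f w)"
      by (simp add: sum_all_words_add sum.cartesian_product case_prod_unfold)
    then show "(\<Sum>p\<in>?S. f (fst p @ snd p)) = 1"
      by (simp add: stationary_sum_1[OF f])
    fix p assume p: "p \<in> ?S"
    show "0 \<le> f (fst p @ snd p)" "0 \<le> f (fst p) * f (snd p)"
      by (simp_all add: f0)
    show "0 < f (fst p) * f (snd p)" if "0 < f (fst p @ snd p)"
      using pos[OF that] p by (simp add: mem_Times_iff)
  qed simp
  also have "(\<Sum>p\<in>?S. f (fst p) * f (snd p)) = (\<Sum>u\<in>all_words m. f u) * (\<Sum>v\<in>all_words n. f v)"
    by (simp add: sum_product sum.cartesian_product case_prod_unfold)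
  finally have "(\<Sum>p\<in>?S. entropy_fun (f (fst p @ snd p)) + f (fst p @ snd p) * ln (f (fst p) * f (snd p))) \<le> 0"
    by (simp add: stationary_sum_1[OF f])
  also have "(\<Sum>p\<in>?S. entropy_fun (f (fst p @ snd p)) + f (fst p @ snd p) * ln (f (fst p) * f (snd p)))
     = (\<Sum>p\<in>?S. entropy_fun (f (fst p @ snd p)) + (f (fst p @ snd p) * ln (f (fst p)) + f (fst p @ snd p) * ln (f (snd p))))"
  proof (rule sum.cong, simp)
    fix p assume p: "p \<in> ?S"
    have "f (fst p @ snd p) * ln (f (fst p) * f (snd p)) =
      f (fst p @ snd p) * ln (f (fst p)) + f (fst p @ snd p) * ln (f (snd p))"
    proof (cases "f (fst p @ snd p) = 0")
      case False
      then have "0 < f (fst p @ snd p)" using f0[of "fst p @ snd p"] by linarith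
      with pos[of "fst p" "snd p"] p have "0 < f (fst p)" "0 < f (snd p)"
        by (simp_all add: mem_Times_iff)
      then show ?thesis by (simp add: ln_mult distrib_left)
    qed simp
    then show "entropy_fun (f (fst p @ snd p)) + f (fst p @ snd p) * ln (f (fst p) * f (snd p)) =
      entropy_fun (f (fst p @ snd p)) + (f (fst p @ snd p) * ln (f (fst p)) + f (fst p @ snd p) * ln (f (snd p)))"
      by simp
  qed
  also have "\<dots> = (\<Sum>w\<in>all_words (m + n). entropy_fun (f w)) +
      (\<Sum>u\<in>all_words m. \<Sum>v\<in>all_words n. f (u @ v) * ln (f u)) +
      (\<Sum>u\<in>all_words m. \<Sum>v\<in>all_words n. f (u @ v) * ln (f v))"
    by (simp add: sum_all_words_add sum.cartesian_product case_prod_unfold sum.distrib)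
  also have "(\<Sum>u\<in>all_words m. \<Sum>v\<in>all_words n. f (u @ v) * ln (f v))
     = (\<Sum>v\<in>all_words n. \<Sum>u\<in>all_words m. f (u @ v) * ln (f v))"
    by (rule sum.swap)
  also have "(\<Sum>u\<in>all_words m. \<Sum>v\<in>all_words n. f (u @ v) * ln (f u)) = - (\<Sum>u\<in>all_words m. entropy_fun (f u))"
    by (auto simp: sum_distrib_right[symmetric] stationary_sum_right[OF f] entropy_fun_def
        sum_negf[symmetric] intro!: sum.cong)
  also have "(\<Sum>v\<in>all_words n. \<Sum>u\<in>all_words m. f (u @ v) * ln (f v)) = - (\<Sum>v\<in>all_words n. entropy_fun (f v))"
    by (auto simp: sum_distrib_right[symmetric] stationary_sum_left[OF f] entropy_fun_def
        sum_negf[symmetric] intro!: sum.cong)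
  finally show "(\<Sum>w\<in>all_words (m + n). entropy_fun (f w))
      \<le> (\<Sum>w\<in>all_words m. entropy_fun (f w)) + (\<Sum>w\<in>all_words n. entropy_fun (f w))"
    by simp
qed

section \<open>Cylinders and invariant measures\<close>

lemma length_initial_word [simp]: "length (initial_word x n) = n"
  by (simp add: initial_word_def)

lemma initial_word_Suc: "initial_word x (Suc n) = x 0 # initial_word (shift x) n"
  unfolding initial_word_def shift_def by (rule map_upt_Suc)

lemma initial_word_Suc_snoc: "initial_word x (Suc n) = initial_word x n @ [x n]"
  by (simp add: initial_word_def)

lemma initial_word_add:
  "initial_word x (m + n) = initial_word x m @ initial_word ((shift ^^ m) x) n"
proof (induction m arbitrary: x)
  case (Suc m)
  then show ?case by (simp add: initial_word_Suc funpow_swap1)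
qed (simp add: initial_word_def)

lemma mem_cylinder: "x \<in> cylinder w \<longleftrightarrow> (\<forall>k<length w. x k = w ! k)"
  unfolding cylinder_def mem_Collect_eq list_eq_iff_nth_eq by (simp add: initial_word_def)

lemma open_cylinder:
  fixes w :: "'i::discrete_topology list"
  shows "open (cylinder w)"
proof -
  have "cylinder w = (\<Inter>k\<in>{..<length w}. (\<lambda>x. x k) -` {w ! k})"
    by (auto simp: mem_cylinder)
  moreover have "open ((\<lambda>x :: nat \<Rightarrow> 'i. x k) -` {w ! k})" for k
    by (rule open_vimage[OF open_discrete continuous_on_product_coordinates])
  ultimately show ?thesis
    by (simp only:) (rule open_INT, simp_all)
qed

text \<open>
  A basic open set of the product topology restricts only finitely many coordinates.
\<close>

lemma open_contains_cylinder:
  fixes U :: "(nat \<Rightarrow> 'i::discrete_topology) set"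
  assumes "open U" "x \<in> U"
  obtains n where "cylinder (initial_word x n) \<subseteq> U"
proof -
  obtain X where X: "x \<in> (\<Pi>\<^sub>E i\<in>UNIV. X i)" "finite {i. X i \<noteq> topspace (euclidean :: 'i topology)}"
      "(\<Pi>\<^sub>E i\<in>UNIV. X i) \<subseteq> U"
    using product_topology_open_contains_basis[of "\<lambda>_. euclidean" UNIV U x] assms
    unfolding open_fun_def by blast
  obtain n where n: "\<And>i. X i \<noteq> UNIV \<Longrightarrow> i < n"
    using X(2) finite_nat_set_iff_bounded[of "{i. X i \<noteq> UNIV}"] by auto
  have "y \<in> U" if "y \<in> cylinder (initial_word x n)" for y
  proof -
    have "y i = x i" if "i < n" for i
      using \<open>y \<in> _\<close> that by (simp add: cylinder_def initial_word_def)
    then have "y \<in> (\<Pi>\<^sub>E i\<in>UNIV. X i)"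
      using X(1) n by (metis PiE_UNIV_domain PiE_mem Pi_I UNIV_I)
    then show ?thesis using X(3) by blast
  qed
  then show thesis using that by blast
qed

lemma words_of_subset: "words_of K n \<subseteq> all_words n"
  by (auto simp: words_of_def all_words_def)

lemma words_of_nonempty: "K \<noteq> {} \<Longrightarrow> words_of K n \<noteq> {}"
  by (simp add: words_of_def)

context
  fixes K :: "(nat \<Rightarrow> 'i::{finite, discrete_topology}) set" and \<mu> :: "(nat \<Rightarrow> 'i) measure"
  assumes \<mu>: "\<mu> \<in> invariant_measures K"
begin

lemma sets_cylinder: "cylinder w \<in> sets \<mu>"
  using \<mu> open_cylinder[of w] by (auto simp: invariant_measures_def)

lemma stationary_cylinder_measure: "stationary (\<lambda>w. measure \<mu> (cylinder w))"
proof -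
  interpret prob_space \<mu> using \<mu> by (simp add: invariant_measures_def)
  have "space \<mu> = UNIV"
    using \<mu> sets_eq_imp_space_eq[of \<mu> borel] by (simp add: invariant_measures_def)
  moreover have "cylinder [] = (UNIV :: (nat \<Rightarrow> 'i) set)"
    by (simp add: cylinder_def initial_word_def)
  ultimately have nil: "measure \<mu> (cylinder []) = 1"
    using prob_space by simp
  have snoc: "(\<Sum>i\<in>UNIV. measure \<mu> (cylinder (w @ [i]))) = measure \<mu> (cylinder w)" for w
  proof -
    have "cylinder w = (\<Union>i. cylinder (w @ [i]))"
      by (auto simp: cylinder_def initial_word_Suc_snoc)
    moreover have "measure \<mu> (\<Union>i. cylinder (w @ [i])) = (\<Sum>i\<in>UNIV. measure \<mu> (cylinder (w @ [i])))"
    proof (rule finite_measure_finite_Union)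
      show "range (\<lambda>i. cylinder (w @ [i])) \<subseteq> sets \<mu>"
        using sets_cylinder by blast
      show "disjoint_family (\<lambda>i. cylinder (w @ [i]))"
        by (auto simp: disjoint_family_on_def cylinder_def initial_word_Suc_snoc)
    qed simp
    ultimately show ?thesis by simp
  qed
  have cons: "(\<Sum>i\<in>UNIV. measure \<mu> (cylinder (i # w))) = measure \<mu> (cylinder w)" for w
  proof -
    have "shift -` cylinder w = (\<Union>i. cylinder (i # w))"
      by (auto simp: cylinder_def initial_word_Suc)
    moreover have "measure \<mu> (shift -` cylinder w) = measure \<mu> (cylinder w)"
      using \<mu> open_cylinder[of w] by (simp add: invariant_measures_def)
    ultimately have "measure \<mu> (cylinder w) = measure \<mu> (\<Union>i. cylinder (i # w))"
      by simp
    also have "\<dots> = (\<Sum>i\<in>UNIV. measure \<mu> (cylinder (i # w)))"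
    proof (rule finite_measure_finite_Union)
      show "range (\<lambda>i. cylinder (i # w)) \<subseteq> sets \<mu>"
        using sets_cylinder by blast
      show "disjoint_family (\<lambda>i. cylinder (i # w))"
        by (auto simp: disjoint_family_on_def cylinder_def initial_word_Suc)
    qed simp
    finally show ?thesis by simp
  qed
  show ?thesis
    using nil snoc cons by (simp add: stationary_def)
qed

text \<open>
  A cylinder that misses \<open>K\<close> contains no point of the support, so it is covered by null cylinders, and there are
  only countably many cylinders.
\<close>

lemma measure_cylinder_eq_0:
  assumes w: "w \<notin> words_of K (length w)"
  shows "measure \<mu> (cylinder w) = 0"
proof -
  let ?N = "{v. cylinder v \<in> null_sets \<mu>}"
  have "cylinder w \<subseteq> (\<Union>v\<in>?N. cylinder v)"
  proof
    fix x assume x: "x \<in> cylinder w"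
    then have "initial_word x (length w) = w"
      by (simp add: cylinder_def)
    then have "x \<notin> K"
      using w unfolding words_of_def by (metis image_eqI)
    then have "x \<notin> measure_support \<mu>"
      using \<mu> by (auto simp: invariant_measures_def)
    then obtain U where U: "open U" "x \<in> U" "emeasure \<mu> U = 0"
      by (auto simp: measure_support_def)
    obtain n where n: "cylinder (initial_word x n) \<subseteq> U"
      using open_contains_cylinder[OF U(1,2)] by blast
    have "U \<in> null_sets \<mu>"
      using U \<mu> by (auto simp: null_sets_def invariant_measures_def)
    then have "cylinder (initial_word x n) \<in> null_sets \<mu>"
      by (rule null_sets_subset[OF _ sets_cylinder n])
    moreover have "x \<in> cylinder (initial_word x n)"
      by (simp add: cylinder_def)
    ultimately show "x \<in> (\<Union>v\<in>?N. cylinder v)" by blast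
  qed
  moreover have "(\<Union>v\<in>?N. cylinder v) \<in> null_sets \<mu>"
    by (rule null_sets_UN') auto
  ultimately have "cylinder w \<in> null_sets \<mu>"
    by (rule null_sets_subset[OF _ sets_cylinder, rotated])
  then show ?thesis by (simp add: measure_def null_setsD1)
qed

lemma sum_words_of_eq:
  "(\<Sum>w\<in>words_of K n. measure \<mu> (cylinder w) * g w) = (\<Sum>w\<in>all_words n. measure \<mu> (cylinder w) * g w)"
proof (rule sum.mono_neutral_left[OF finite_all_words words_of_subset], rule ballI)
  fix w assume "w \<in> all_words n - words_of K n"
  then have "w \<notin> words_of K (length w)" by (simp add: all_words_def)
  then show "measure \<mu> (cylinder w) * g w = 0"
    by (simp add: measure_cylinder_eq_0)
qed

end

section \<open>Pressure, energy and Lyapunov exponents\<close>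

lemma finite_words_of [simp]: "finite (words_of K n :: 'i::finite list set)"
  by (rule finite_subset[OF words_of_subset finite_all_words])

lemma funpow_shift_invariant:
  assumes "shift ` K \<subseteq> K" "x \<in> K"
  shows "(shift ^^ m) x \<in> K"
  using assms by (induction m) auto

text \<open>
  Cutting a word of \<open>K\<close> gives two words of \<open>K\<close>, because \<open>K\<close> is mapped into itself by the shift; hence the sums
  are submultiplicative.
\<close>

lemma convergent_log_partition_sum:
  fixes A :: "'i::finite \<Rightarrow> real^'d^'d"
  assumes A: "\<And>i. invertible (A i)" and K: "K \<noteq> {}" "shift ` K \<subseteq> K" and G: "log_submult G"
  shows "convergent (\<lambda>n. 1 / real n * ln (\<Sum>w\<in>words_of K n. exp (G (word_matrix A w))))"
proof -
  obtain C where C: "\<And>w. - C * real (length w) \<le> G (word_matrix A w)"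
    using log_submult_lower_bound[of A G] A G by blast
  let ?F = "\<lambda>w. exp (G (word_matrix A w))"
  have pos: "0 < (\<Sum>w\<in>words_of K n. ?F w)" for n
    using words_of_nonempty[OF K(1)] by (intro sum_pos) auto
  show ?thesis
  proof (rule fekete)
    show "- C * real n \<le> ln (\<Sum>w\<in>words_of K n. ?F w)" for n
    proof -
      obtain x where "x \<in> K" using K by blast
      then have x: "initial_word x n \<in> words_of K n" by (simp add: words_of_def)
      have "- C * real n \<le> ln (?F (initial_word x n))"
        using C[of "initial_word x n"] by simp
      also have "\<dots> \<le> ln (\<Sum>w\<in>words_of K n. ?F w)"
        using pos[of n] x by (intro ln_mono member_le_sum) auto
      finally show ?thesis .
    qed
    fix m n
    let ?P = "words_of K m \<times> words_of K n"
    have "words_of K (m + n) \<subseteq> (\<lambda>(u, v). u @ v) ` ?P"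
    proof
      fix w assume "w \<in> words_of K (m + n)"
      then obtain x where x: "x \<in> K" "w = initial_word x (m + n)"
        by (auto simp: words_of_def)
      then show "w \<in> (\<lambda>(u, v). u @ v) ` ?P"
        using funpow_shift_invariant[OF K(2) x(1), of m]
        by (intro image_eqI[of _ _ "(initial_word x m, initial_word ((shift ^^ m) x) n)"])
          (auto simp: words_of_def initial_word_add)
    qed
    then have "(\<Sum>w\<in>words_of K (m + n). ?F w) \<le> (\<Sum>w\<in>(\<lambda>(u, v). u @ v) ` ?P. ?F w)"
      by (intro sum_mono2) auto
    also have "\<dots> = (\<Sum>p\<in>?P. ?F (fst p @ snd p))"
    proof -
      have "inj_on (\<lambda>(u, v). u @ v) ?P"
        by (auto simp: inj_on_def words_of_def)
      then show ?thesis by (simp add: sum.reindex case_prod_unfold o_def)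
    qed
    also have "\<dots> \<le> (\<Sum>p\<in>?P. ?F (fst p) * ?F (snd p))"
    proof (rule sum_mono)
      fix p assume "p \<in> ?P"
      have "G (word_matrix A (fst p @ snd p)) \<le> G (word_matrix A (fst p)) + G (word_matrix A (snd p))"
        using G invertible_word_matrix[of A, OF A] unfolding log_submult_def word_matrix_append by blast
      then show "?F (fst p @ snd p) \<le> ?F (fst p) * ?F (snd p)"
        by (simp add: exp_add[symmetric])
    qed
    also have "\<dots> = (\<Sum>u\<in>words_of K m. ?F u) * (\<Sum>v\<in>words_of K n. ?F v)"
      by (simp add: sum_product sum.cartesian_product case_prod_unfold)
    finally have "ln (\<Sum>w\<in>words_of K (m + n). ?F w)
        \<le> ln ((\<Sum>u\<in>words_of K m. ?F u) * (\<Sum>v\<in>words_of K n. ?F v))"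
      by (rule ln_mono[OF _ pos])
    then show "ln (\<Sum>w\<in>words_of K (m + n). ?F w)
        \<le> ln (\<Sum>u\<in>words_of K m. ?F u) + ln (\<Sum>v\<in>words_of K n. ?F v)"
      using pos[of m] pos[of n] by (simp add: ln_mult)
  qed
qed

context
  fixes A :: "'i::{finite, discrete_topology} \<Rightarrow> real^'d^'d" and K :: "(nat \<Rightarrow> 'i) set" and l :: nat
  assumes A: "\<And>i. invertible (A i)" and K: "K \<noteq> {}" "shift ` K \<subseteq> K" and l: "l < CARD('d)"
begin

lemma invertible_words: "invertible (word_matrix A w)"
  by (rule invertible_word_matrix) (rule A)

lemma pressure_tendsto:
  assumes t: "real l \<le> t" "t < real l + 1"
  shows "(\<lambda>n. 1 / real n * ln (\<Sum>w\<in>words_of K n. svf t (word_matrix A w))) \<longlonglongrightarrow> pressure A K t"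
proof -
  have "convergent (\<lambda>n. 1 / real n * ln (\<Sum>w\<in>words_of K n. exp (ln (svf t (word_matrix A w)))))"
    by (rule convergent_log_partition_sum[OF A K log_submult_svf[OF t l]])
  then show ?thesis
    unfolding pressure_def by (simp add: convergent_LIMSEQ_iff svf_pos[OF invertible_words t l])
qed

text \<open>
  On the open cell the pressure is a pointwise limit of scaled log-sum-exp functions.
\<close>

lemma convex_on_pressure: "convex_on {real l<..<real l + 1} (pressure A K)"
proof -
  let ?I = "{real l<..<real l + 1}"
  define F where "F n t = 1 / real n * ln (\<Sum>w\<in>words_of K n. svf t (word_matrix A w))" for n t
  define a b where "a w = ln (sing_prod l (word_matrix A w)) - real l * ln (sing_val (word_matrix A w) (Suc l))"
    and "b w = ln (sing_val (word_matrix A w) (Suc l))" for w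
  have Feq: "F n t = 1 / real n * ln (\<Sum>w\<in>words_of K n. exp (a w + b w * t))" if "t \<in> ?I" for n t
  proof -
    have t: "real l \<le> t" "t < real l + 1" using that by auto
    have "svf t (word_matrix A w) = exp (a w + b w * t)" for w
      unfolding svf_eq_exp[OF invertible_words t l] a_def b_def by (simp add: algebra_simps)
    then show ?thesis by (simp add: F_def)
  qed
  have conv: "convex_on UNIV (\<lambda>t. 1 / real n * ln (\<Sum>w\<in>words_of K n. exp (a w + b w * t)))" for n
    by (rule convex_on_cmul, simp, rule convex_on_log_sum_exp) (use words_of_nonempty[OF K(1)] in auto)
  have lim: "(\<lambda>n. F n t) \<longlonglongrightarrow> pressure A K t" if "t \<in> ?I" for t
    unfolding F_def using that by (intro pressure_tendsto) auto
  show ?thesis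
  proof (rule convex_onI)
    fix t x y :: real assume t: "0 < t" "t < 1" and xy: "x \<in> ?I" "y \<in> ?I"
    have z: "(1 - t) *\<^sub>R x + t *\<^sub>R y \<in> ?I"
      using convex_real_interval(8)[of "real l" "real l + 1"] xy t unfolding convex_alt by auto
    have "F n ((1 - t) *\<^sub>R x + t *\<^sub>R y) \<le> (1 - t) * F n x + t * F n y" for n
      unfolding Feq[OF z] Feq[OF xy(1)] Feq[OF xy(2)]
      using convex_onD[OF conv[of n], of t x y] t by simp
    then show "pressure A K ((1 - t) *\<^sub>R x + t *\<^sub>R y) \<le> (1 - t) * pressure A K x + t * pressure A K y"
      by (intro LIMSEQ_le[OF lim[OF z] tendsto_add[OF tendsto_mult_left[OF lim[OF xy(1)]]
            tendsto_mult_left[OF lim[OF xy(2)]]]]) auto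
  qed simp
qed

context
  fixes \<mu> :: "(nat \<Rightarrow> 'i) measure"
  assumes \<mu>: "\<mu> \<in> invariant_measures K"
begin

lemma energy_tendsto:
  assumes t: "real l \<le> t" "t < real l + 1"
  shows "(\<lambda>n. 1 / real n * (\<Sum>w\<in>all_words n. measure \<mu> (cylinder w) * ln (svf t (word_matrix A w))))
      \<longlonglongrightarrow> energy A t \<mu>"
  unfolding energy_def convergent_LIMSEQ_iff[symmetric]
  by (rule convergent_stationary_average[OF stationary_cylinder_measure[OF \<mu>] A log_submult_svf[OF t l]])

text \<open>
  The logarithm of a singular value is a difference of two log-submultiplicative functions, whose averages
  converge.
\<close>

lemma lyap_tendsto:
  "(\<lambda>n. 1 / real n * (\<Sum>w\<in>all_words n. measure \<mu> (cylinder w) * ln (sing_val (word_matrix A w) (Suc l))))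
      \<longlonglongrightarrow> lyap A K (Suc l) \<mu>"
proof -
  have "convergent (\<lambda>n. 1 / real n * (\<Sum>w\<in>all_words n. measure \<mu> (cylinder w) * ln (sing_prod k (word_matrix A w))))"
    if "k \<le> CARD('d)" for k
    by (rule convergent_stationary_average[OF stationary_cylinder_measure[OF \<mu>] A log_submult_sing_prod[OF that]])
  from convergent_diff[OF this[of "Suc l"] this[of l]] l
  have "convergent (\<lambda>n. 1 / real n * (\<Sum>w\<in>all_words n. measure \<mu> (cylinder w) * ln (sing_val (word_matrix A w) (Suc l))))"
    by (simp add: ln_sing_val[OF invertible_words] right_diff_distrib sum_subtractf)
  then show ?thesis
    unfolding lyap_def sum_words_of_eq[OF \<mu>] convergent_LIMSEQ_iff .
qed

lemma energy_affine:
  assumes t: "real l \<le> t" "t < real l + 1" and s: "real l \<le> s" "s < real l + 1"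
  shows "energy A s \<mu> = energy A t \<mu> + lyap A K (Suc l) \<mu> * (s - t)"
proof -
  have "ln (svf s (word_matrix A w)) = ln (svf t (word_matrix A w)) + ln (sing_val (word_matrix A w) (Suc l)) * (s - t)" for w
    by (simp add: svf_eq_exp[OF invertible_words s l] svf_eq_exp[OF invertible_words t l] algebra_simps)
  then have "(\<lambda>n. 1 / real n * (\<Sum>w\<in>all_words n. measure \<mu> (cylinder w) * ln (svf s (word_matrix A w)))) =
     (\<lambda>n. 1 / real n * (\<Sum>w\<in>all_words n. measure \<mu> (cylinder w) * ln (svf t (word_matrix A w))) +
       1 / real n * (\<Sum>w\<in>all_words n. measure \<mu> (cylinder w) * ln (sing_val (word_matrix A w) (Suc l))) * (s - t))"
    by (simp add: distrib_left sum.distrib sum_distrib_right mult.assoc)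
  then show ?thesis
    using LIMSEQ_unique[OF energy_tendsto[OF s]]
      tendsto_add[OF energy_tendsto[OF t] tendsto_mult_right[OF lyap_tendsto]] by simp
qed

text \<open>
  The easy half of the variational principle: the Gibbs inequality for the cylinder probabilities against the
  values of the singular value function.
\<close>

lemma entropy_plus_energy_le_pressure:
  assumes t: "real l \<le> t" "t < real l + 1"
  shows "measure_entropy \<mu> + energy A t \<mu> \<le> pressure A K t"
proof (rule LIMSEQ_le[OF tendsto_add[OF _ energy_tendsto[OF t]] pressure_tendsto[OF t]])
  show "(\<lambda>n. 1 / real n * (\<Sum>w\<in>all_words n. entropy_fun (measure \<mu> (cylinder w)))) \<longlonglongrightarrow> measure_entropy \<mu>"
    unfolding measure_entropy_def convergent_LIMSEQ_iff[symmetric]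
    by (rule convergent_entropy[OF stationary_cylinder_measure[OF \<mu>]])
  let ?f = "\<lambda>w. measure \<mu> (cylinder w)"
  have "(\<Sum>w\<in>all_words n. entropy_fun (?f w)) + (\<Sum>w\<in>all_words n. ?f w * ln (svf t (word_matrix A w)))
      \<le> ln (\<Sum>w\<in>words_of K n. svf t (word_matrix A w))" for n
  proof -
    have "(\<Sum>w\<in>words_of K n. entropy_fun (?f w) + ?f w * ln (svf t (word_matrix A w)))
        \<le> ln (\<Sum>w\<in>words_of K n. svf t (word_matrix A w))"
    proof (rule gibbs_inequality)
      show "sum ?f (words_of K n) = 1"
        using sum_words_of_eq[OF \<mu>, of "\<lambda>_. 1" n] stationary_sum_1[OF stationary_cylinder_measure[OF \<mu>], of n]
        by simp
    qed (use svf_pos[OF invertible_words t l] in \<open>auto intro: less_imp_le\<close>)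
    moreover have "(\<Sum>w\<in>words_of K n. entropy_fun (?f w)) = (\<Sum>w\<in>all_words n. entropy_fun (?f w))"
    proof (rule sum.mono_neutral_left[OF finite_all_words words_of_subset], rule ballI)
      fix w assume "w \<in> all_words n - words_of K n"
      then have "w \<notin> words_of K (length w)" by (simp add: all_words_def)
      then show "entropy_fun (?f w) = 0"
        by (simp add: measure_cylinder_eq_0[OF \<mu>] entropy_fun_def)
    qed
    ultimately show ?thesis
      by (simp add: sum.distrib sum_words_of_eq[OF \<mu>])
  qed
  then have "1 / real n * ((\<Sum>w\<in>all_words n. entropy_fun (?f w)) + (\<Sum>w\<in>all_words n. ?f w * ln (svf t (word_matrix A w))))
      \<le> 1 / real n * ln (\<Sum>w\<in>words_of K n. svf t (word_matrix A w))" for n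
    by (rule mult_left_mono) simp
  then show "\<exists>N. \<forall>n\<ge>N. 1 / real n * (\<Sum>w\<in>all_words n. entropy_fun (?f w)) +
      1 / real n * (\<Sum>w\<in>all_words n. ?f w * ln (svf t (word_matrix A w)))
      \<le> 1 / real n * ln (\<Sum>w\<in>words_of K n. svf t (word_matrix A w))"
    by (simp only: distrib_left) blast
qed

end

text \<open>
  Entropy plus energy is affine in the parameter, lies below the pressure, and touches it at \<open>t\<close>.
\<close>

lemma lyap_subgradient:
  assumes eq: "equilibrium_measure A K t \<mu>" and t: "real l \<le> t" "t < real l + 1"
    and s: "real l \<le> s" "s < real l + 1"
  shows "pressure A K t + lyap A K (Suc l) \<mu> * (s - t) \<le> pressure A K s"
proof -
  have \<mu>: "\<mu> \<in> invariant_measures K" and eq: "pressure A K t = measure_entropy \<mu> + energy A t \<mu>"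
    using eq by (auto simp: equilibrium_measure_def)
  have "pressure A K t + lyap A K (Suc l) \<mu> * (s - t) = measure_entropy \<mu> + energy A s \<mu>"
    unfolding eq energy_affine[OF \<mu> t s] by simp
  also have "\<dots> \<le> pressure A K s"
    by (rule entropy_plus_energy_le_pressure[OF \<mu> s])
  finally show ?thesis .
qed

end

section \<open>One-sided derivatives of the pressure\<close>

theorem lemma4p2:
  fixes A :: "'i::{finite, discrete_topology} \<Rightarrow> real^'d^'d"
    and K :: "(nat \<Rightarrow> 'i) set"
    and \<alpha> :: real
  assumes "CARD('i) \<ge> 2"
    and "0 < \<alpha>" and "\<alpha> < 1"
    and "\<And>i. invertible (A i)"
    and "\<And>i. onorm ((*v) (A i)) \<le> \<alpha>"
    and "K \<noteq> {}" and "compact K" and "shift ` K \<subseteq> K"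
  shows
    "(\<forall>t \<mu>. 0 < t \<and> t < real CARD('d) \<and> t \<notin> \<nat> \<and> equilibrium_measure A K t \<mu> \<longrightarrow>
        (\<exists>Dl Dr.
          ((\<lambda>\<delta>. (pressure A K (t + \<delta>) - pressure A K t) / \<delta>) \<longlongrightarrow> Dl) (at_left 0) \<and>
          ((\<lambda>\<delta>. (pressure A K (t + \<delta>) - pressure A K t) / \<delta>) \<longlongrightarrow> Dr) (at_right 0) \<and>
          Dl \<le> lyap A K (nat \<lfloor>t\<rfloor> + 1) \<mu> \<and> lyap A K (nat \<lfloor>t\<rfloor> + 1) \<mu> \<le> Dr)) \<and>
     (\<exists>C. countable C \<and>
        (\<forall>t. 0 < t \<and> t < real CARD('d) \<and> t \<notin> C \<longrightarrow>
          (\<exists>D. (pressure A K has_real_derivative D) (at t) \<and>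
               (\<forall>\<mu>. equilibrium_measure A K t \<mu> \<longrightarrow> D = lyap A K (nat \<lfloor>t\<rfloor> + 1) \<mu>))))"
proof -
  note A = assms(4) and K = assms(6,8)
  let ?P = "pressure A K"
  have cell: "nat \<lfloor>t\<rfloor> < CARD('d) \<and> t \<in> {real (nat \<lfloor>t\<rfloor>)<..<real (nat \<lfloor>t\<rfloor>) + 1}"
    if "0 < t" "t < real CARD('d)" "t \<notin> \<nat>" for t
  proof -
    have "real (nat \<lfloor>t\<rfloor>) \<noteq> t" using that(3) by (metis of_nat_in_Nats)
    then show ?thesis using that(1,2) by (auto simp: less_le) linarith+
  qed
  have sub: "?P t + lyap A K (nat \<lfloor>t\<rfloor> + 1) \<mu> * (s - t) \<le> ?P s"
    if "0 < t" "t < real CARD('d)" "t \<notin> \<nat>" "equilibrium_measure A K t \<mu>"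
      "s \<in> {real (nat \<lfloor>t\<rfloor>)<..<real (nat \<lfloor>t\<rfloor>) + 1}" for t \<mu> s
    using lyap_subgradient[of A K "nat \<lfloor>t\<rfloor>" t \<mu> s, OF A K] cell[OF that(1-3)] that(4,5) by auto
  show ?thesis
  proof (intro conjI allI impI)
    fix t \<mu> assume t: "0 < t \<and> t < real CARD('d) \<and> t \<notin> \<nat> \<and> equilibrium_measure A K t \<mu>"
    let ?l = "nat \<lfloor>t\<rfloor>"
    have c: "?l < CARD('d)" "t \<in> {real ?l<..<real ?l + 1}"
      using cell[of t] t by auto
    obtain Dl Dr where D: "(diff_quot ?P t \<longlongrightarrow> Dl) (at_left 0)" "(diff_quot ?P t \<longlongrightarrow> Dr) (at_right 0)"
      using convex_on_one_sided_derivatives[OF convex_on_pressure[of A K, OF A K c(1)] c(2)] by blast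
    have "?P t + lyap A K (?l + 1) \<mu> * (s - t) \<le> ?P s" if "s \<in> {real ?l<..<real ?l + 1}" for s
      using sub[of t \<mu> s] t that by blast
    note subgradient_between_one_sided_derivatives[where f = ?P and m = "lyap A K (?l + 1) \<mu>", OF c(2) this D]
    with D show "\<exists>Dl Dr. (diff_quot ?P t \<longlongrightarrow> Dl) (at_left 0) \<and> (diff_quot ?P t \<longlongrightarrow> Dr) (at_right 0) \<and>
        Dl \<le> lyap A K (?l + 1) \<mu> \<and> lyap A K (?l + 1) \<mu> \<le> Dr"
      by blast
  next
    define C where "C = (\<nat> :: real set) \<union>
      (\<Union>l<CARD('d). {t \<in> {real l<..<real l + 1}. \<not> (\<exists>D. (?P has_real_derivative D) (at t))})"
    have "countable (\<nat> :: real set)"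
      by (simp add: Nats_def)
    moreover have "countable (\<Union>l<CARD('d). {t \<in> {real l<..<real l + 1}.
        \<not> (\<exists>D. (?P has_real_derivative D) (at t))})"
    proof (rule countable_UN)
      fix l assume "l \<in> {..<CARD('d)}"
      then have "convex_on {real l<..<real l + 1} ?P"
        using convex_on_pressure[of A K l, OF A K] by simp
      then show "countable {t \<in> {real l<..<real l + 1}. \<not> (\<exists>D. (?P has_real_derivative D) (at t))}"
        by (rule convex_on_countable_nondifferentiable)
    qed simp
    ultimately have "countable C"
      unfolding C_def by simp
    moreover have "\<exists>D. (?P has_real_derivative D) (at t) \<and>
        (\<forall>\<mu>. equilibrium_measure A K t \<mu> \<longrightarrow> D = lyap A K (nat \<lfloor>t\<rfloor> + 1) \<mu>)"
      if t: "0 < t" "t < real CARD('d)" "t \<notin> C" for t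
    proof -
      have tN: "t \<notin> \<nat>" using t(3) by (simp add: C_def)
      note c = cell[OF t(1,2) tN]
      obtain D where D: "(?P has_real_derivative D) (at t)"
        using t(3) c unfolding C_def by blast
      have "D = lyap A K (nat \<lfloor>t\<rfloor> + 1) \<mu>" if "equilibrium_measure A K t \<mu>" for \<mu>
        by (rule subgradient_eq_derivative[where f = ?P, OF conjunct2[OF c] _ D])
          (rule sub[OF t(1,2) tN that])
      with D show ?thesis by blast
    qed
    ultimately show "\<exists>C. countable C \<and> (\<forall>t. 0 < t \<and> t < real CARD('d) \<and> t \<notin> C \<longrightarrow>
          (\<exists>D. (?P has_real_derivative D) (at t) \<and>
               (\<forall>\<mu>. equilibrium_measure A K t \<mu> \<longrightarrow> D = lyap A K (nat \<lfloor>t\<rfloor> + 1) \<mu>)))"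
      by blast
  qed
qed

end
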